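(* Let $F$ be an algebraically closed field, let $A_0$ be a commutative domain over $F$ (that is, a commutative $F$-algebra which is an integral domain), and let $A$ be a quantum formal deformation of $A_0$ over $F[[\hbar]]$. Suppose that $A$ is a PI algebra of degree $d$. (i) If $\operatorname{char} F=0$, then $d=1$ (i.e., $A$ is commutative). (ii) If $\operatorname{char} F=p>0$, then $d$ is a power of $p$.
   Context: Algebras are associative and unital. A quantum formal deformation of a commutative $F$-algebra $A_0$ over $F[[\hbar]]$ is an $F[[\hbar]]$-algebra $A$ (not necessarily commutative) which is isomorphic to $A_0[[\hbar]]$ as an $F[[\hbar]]$-module and is equipped with an isomorphism of algebras $A/(\hbar)\cong A_0$. When $A_0$ is a domain, so is $A$. A PI algebra is an algebra satisfying a nontrivial polynomial identity. A PI domain $A$ has a quotient division algebra, which is finite dimensional over its center; $A$ is PI of degree $d$ if this dimension is $d^2$ (equivalently, $A$ satisfies the polynomial identities of $d\times d$ matrices but not those of matrices of smaller size). A power of $p$ means $p^k$ with $k\ge 0$ an integer. *)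

theory Defs
  imports "HOL-Computational_Algebra.Computational_Algebra" "HOL-Library.Poly_Mapping"
begin

section \<open>Associative unital algebras\<close>

locale unital_algebra = module scale
  for scale :: "'r::comm_ring_1 \<Rightarrow> 'a::ring_1 \<Rightarrow> 'a" +
  assumes scale_mult_left: "scale r a * b = scale r (a * b)"
    and scale_mult_right: "a * scale r b = scale r (a * b)"


section \<open>Quantum formal deformations\<close>

text \<open>The action of \<open>F[[\<hbar>]]\<close> on \<open>A\<^sub>0[[\<hbar>]]\<close> induced by the action \<open>s\<close> of \<open>F\<close> on \<open>A\<^sub>0\<close>; the
  formal parameter \<open>\<hbar>\<close> is \<^const>\<open>fps_X\<close>.\<close>

definition fps_scale :: "('f::comm_ring_1 \<Rightarrow> 'b::ring_1 \<Rightarrow> 'b) \<Rightarrow> 'f fps \<Rightarrow> 'b fps \<Rightarrow> 'b fps" where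
  "fps_scale s f g = Abs_fps (\<lambda>n. \<Sum>i\<le>n. s (fps_nth f i) (fps_nth g (n - i)))"

lemma module_fps_scale:
  assumes "unital_algebra s"
  shows "module (fps_scale s)"
proof -
  interpret unital_algebra s by fact
  define e where "e f = Abs_fps (\<lambda>n. s (fps_nth f n) 1)" for f
  have s: "s c x = s c 1 * x" for c x by (simp add: scale_mult_left)
  have fs: "fps_scale s f g = e f * g" for f g
    unfolding fps_scale_def e_def
    by (rule fps_ext) (simp add: fps_mult_nth scale_mult_left atLeast0AtMost)
  have e_mult: "e (f * g) = e f * e g" for f g
    unfolding e_def
    by (rule fps_ext) (simp add: fps_mult_nth scale_sum_left scale_mult_left mult.commute)
  have e_add: "e (f + g) = e f + e g" for f g
    unfolding e_def by (rule fps_ext) (simp add: scale_left_distrib)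
  have e_one: "e 1 = 1"
    unfolding e_def by (rule fps_ext) simp
  show ?thesis
    by unfold_locales (simp_all add: fs e_mult e_add e_one distrib_left distrib_right mult.assoc)
qed

text \<open>The elements of \<open>A/(\<hbar>)\<close> are the cosets \<open>a + \<hbar>A\<close>; as \<open>\<hbar>\<close> acts centrally, the
  two-sided ideal \<open>(\<hbar>)\<close> is \<open>\<hbar>A\<close>.\<close>

definition hbar_coset :: "('f::field fps \<Rightarrow> 'a::ring_1 \<Rightarrow> 'a) \<Rightarrow> 'a \<Rightarrow> 'a set" where
  "hbar_coset sA a = {a + sA fps_X x | x. True}"

text \<open>\<open>\<psi>\<close> is the isomorphism of \<open>F\<close>-algebras \<open>A/(\<hbar>) \<cong> A\<^sub>0\<close> with which the deformation is equipped;
  its values outside the set of cosets are irrelevant.\<close>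

locale quantum_formal_deformation =
  A0: unital_algebra s0 + A: unital_algebra sA
  for s0 :: "'f::field \<Rightarrow> 'b::comm_ring_1 \<Rightarrow> 'b"
    and sA :: "'f fps \<Rightarrow> 'a::ring_1 \<Rightarrow> 'a" +
  fixes \<psi> :: "'a set \<Rightarrow> 'b"
  assumes module_iso: "\<exists>\<phi> :: 'a \<Rightarrow> 'b fps. module_hom sA (fps_scale s0) \<phi> \<and> bij \<phi>"
    and \<psi>_bij: "bij_betw \<psi> (range (hbar_coset sA)) UNIV"
    and \<psi>_add: "\<psi> (hbar_coset sA (a + b)) = \<psi> (hbar_coset sA a) + \<psi> (hbar_coset sA b)"
    and \<psi>_mult: "\<psi> (hbar_coset sA (a * b)) = \<psi> (hbar_coset sA a) * \<psi> (hbar_coset sA b)"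
    and \<psi>_one: "\<psi> (hbar_coset sA 1) = 1"
    and \<psi>_scale: "\<psi> (hbar_coset sA (sA (fps_const c) a)) = s0 c (\<psi> (hbar_coset sA a))"


section \<open>Polynomial identities\<close>

text \<open>A noncommutative polynomial in the variables \<open>x\<^sub>0, x\<^sub>1, \<dots>\<close> is represented by its finitely
  supported family of coefficients, a monomial being the word of the indices of its factors.\<close>

type_synonym 'r nc_poly = "nat list \<Rightarrow>\<^sub>0 'r"

definition nc_eval :: "('r::comm_ring_1 \<Rightarrow> 'a::ring_1 \<Rightarrow> 'a) \<Rightarrow> (nat \<Rightarrow> 'a) \<Rightarrow> 'r nc_poly \<Rightarrow> 'a" where
  "nc_eval scale x f =
     (\<Sum>w\<in>Poly_Mapping.keys f. scale (Poly_Mapping.lookup f w) (prod_list (map x w)))"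

definition PI_algebra :: "('r::comm_ring_1 \<Rightarrow> 'a::ring_1 \<Rightarrow> 'a) \<Rightarrow> bool" where
  "PI_algebra scale \<longleftrightarrow> unital_algebra scale \<and>
     (\<exists>f :: 'r nc_poly. f \<noteq> 0 \<and> (\<forall>x. nc_eval scale x f = 0))"


section \<open>The center of a division ring\<close>

typedef (overloaded) 'd center = "{z :: 'd::division_ring. \<forall>x. z * x = x * z}"
  morphisms of_center to_center
  by (rule exI[of _ 0]) simp

setup_lifting type_definition_center

lemma inverse_central:
  fixes z x :: "'d::division_ring"
  assumes z: "\<forall>x. z * x = x * z"
  shows "inverse z * x = x * inverse z"
proof (cases "z = 0")
  case False
  have "inverse z * x = inverse z * (x * z) * inverse z"
    using False by (simp add: mult.assoc)
  also have "\<dots> = inverse z * (z * x) * inverse z"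
    by (simp only: spec[OF z])
  also have "\<dots> = x * inverse z"
    using False by (simp add: mult.assoc[symmetric])
  finally show ?thesis .
qed simp

instantiation center :: (division_ring) field
begin

lift_definition zero_center :: "'a center" is 0 by simp
lift_definition one_center :: "'a center" is 1 by simp
lift_definition plus_center :: "'a center \<Rightarrow> 'a center \<Rightarrow> 'a center" is "(+)"
  by (metis distrib_left distrib_right)
lift_definition minus_center :: "'a center \<Rightarrow> 'a center \<Rightarrow> 'a center" is "(-)"
  by (metis left_diff_distrib right_diff_distrib)
lift_definition uminus_center :: "'a center \<Rightarrow> 'a center" is uminus
  by (metis mult_minus_left mult_minus_right)
lift_definition times_center :: "'a center \<Rightarrow> 'a center \<Rightarrow> 'a center" is "(*)"
  by (metis mult.assoc)
lift_definition inverse_center :: "'a center \<Rightarrow> 'a center" is inverse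
  using inverse_central by blast
definition divide_center :: "'a center \<Rightarrow> 'a center \<Rightarrow> 'a center" where
  "divide_center x y = x * inverse y"

instance
proof
  fix a b c :: "'a center"
  show "a * b * c = a * (b * c)" by transfer (rule mult.assoc)
  show "a * b = b * a" by transfer blast
  show "1 * a = a" by transfer (rule mult_1_left)
  show "a + b + c = a + (b + c)" by transfer (rule add.assoc)
  show "a + b = b + a" by transfer (rule add.commute)
  show "0 + a = a" by transfer (rule add_0_left)
  show "- a + a = 0" by transfer (rule left_minus)
  show "a - b = a + - b" by transfer (rule diff_conv_add_uminus)
  show "(a + b) * c = a * c + b * c" by transfer (rule distrib_right)
  show "(0 :: 'a center) \<noteq> 1" by transfer (rule zero_neq_one)
  show "a \<noteq> 0 \<Longrightarrow> inverse a * a = 1" by transfer (rule left_inverse)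
  show "a div b = a * inverse b" by (rule divide_center_def)
  show "inverse (0 :: 'a center) = 0" by transfer (rule inverse_zero)
qed

end

definition center_scale :: "'d::division_ring center \<Rightarrow> 'd \<Rightarrow> 'd" where
  "center_scale z x = of_center z * x"

lemma vector_space_center_scale: "vector_space center_scale"
  by unfold_locales
    (simp_all add: center_scale_def distrib_left distrib_right mult.assoc
      plus_center.rep_eq times_center.rep_eq one_center.rep_eq)


section \<open>PI degree\<close>

text \<open>The embedding \<open>\<iota>\<close> exhibits the division ring \<open>'d\<close> as the quotient division ring of \<open>'a\<close>,
  every element being a right fraction. A PI domain satisfies both Ore conditions, so that right
  and left fractions yield the same division ring.\<close>

locale quotient_division_ring =
  fixes \<iota> :: "'a::ring_1 \<Rightarrow> 'd::division_ring"
  assumes emb_add: "\<iota> (a + b) = \<iota> a + \<iota> b"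
    and emb_mult: "\<iota> (a * b) = \<iota> a * \<iota> b"
    and emb_one: "\<iota> 1 = 1"
    and emb_inj: "inj \<iota>"
    and fraction: "\<exists>a b. b \<noteq> 0 \<and> x = \<iota> a * inverse (\<iota> b)"

text \<open>HOL cannot quantify over the type \<open>'d\<close> inside a definition, so the quotient division
  algebra, which is unique up to isomorphism, is a parameter of the predicate. Finiteness
  of the dimension is part of \<^locale>\<open>finite_dimensional_vector_space\<close>; in particular \<open>d \<noteq> 0\<close>.\<close>

definition PI_degree ::
  "('r::comm_ring_1 \<Rightarrow> 'a::ring_1 \<Rightarrow> 'a) \<Rightarrow> ('a \<Rightarrow> 'd::division_ring) \<Rightarrow> nat \<Rightarrow> bool" where
  "PI_degree scale \<iota> d \<longleftrightarrow> PI_algebra scale \<and> quotient_division_ring \<iota> \<and>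
     (\<exists>B :: 'd set. finite_dimensional_vector_space center_scale B \<and> card B = d\<^sup>2)"

end

(* Let h be the image of the formal parameter in the quotient division ring D of A. Since A/(h) = A0
is a commutative domain, D carries an h-adic valuation ring V with V/hV = K, the field of fractions
of A0. Let Z be the center of D and k the image of Z \<inter> V in K. For linearly independent elements
of D over Z there are maps x \<mapsto> \<Sum> u x w with prescribed values on them; these maps are h-adically
bounded, so finite-dimensional Z-subspaces are closed. Hence lifting a k-basis of K gives a Z-basis
of D, and [K : k] = d^2, as h is central.

In characteristic p, if [a, V] \<subseteq> h^n V then [a^p, V] \<subseteq> h^(n+1) V, so that a^(p^n) is close to the
center and its residue lies in k for large n. Thus K/k is purely inseparable and d^2 is a power of p.

In characteristic 0, if D is not commutative, the leading term of the commutator is a nonzero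
Poisson bracket on K for which k is central. As K/k is algebraic and separable, all derivations
of K over k vanish, a contradiction. *)

theory Submission
  imports Defs
begin

section \<open>Multiplication operators of a division ring\<close>

text \<open>The equality [K : k] = d^2 is the fundamental equality "ramification index times residue
  degree" with ramification index 1: since h lies in Z, it is a uniformizer of both D and Z. What
  has to be excluded is a defect, that is, a lifted basis whose span is merely dense. D is not
  completed for this purpose; expansions in powers of h are cut off at a finite order, and a bounded
  operator that vanishes on the span but not at a missed element detects the gap.

  The same operators explain why small commutators force a residue into k. An operator x \<mapsto>
  \<Sum> u x w almost commutes with multiplication by an element b of small commutators, so it is
  nearly determined by its value at 1. Applied to the operators dual to a basis of D that contains
  1, this makes all coordinates of b small except the one at 1, which is central.\<close>

inductive mult_op :: "('d::division_ring \<Rightarrow> 'd) \<Rightarrow> bool" where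
  base: "mult_op (\<lambda>x. u * x * w)"
| add: "mult_op f \<Longrightarrow> mult_op g \<Longrightarrow> mult_op (\<lambda>x. f x + g x)"

lemma mult_op_mult_left: "mult_op f \<Longrightarrow> mult_op (\<lambda>x. c * f x)"
proof (induction rule: mult_op.induct)
  case (base u w)
  show ?case using mult_op.base[of "c * u" w] by (simp add: mult.assoc)
qed (simp add: distrib_left mult_op.add)

lemma mult_op_mult_right: "mult_op f \<Longrightarrow> mult_op (\<lambda>x. f x * c)"
proof (induction rule: mult_op.induct)
  case (base u w)
  show ?case using mult_op.base[of u "w * c"] by (simp add: mult.assoc)
qed (simp add: distrib_right mult_op.add)

lemma mult_op_id: "mult_op (\<lambda>x. x)"
  using mult_op.base[of 1 1] by simp

lemma mult_op_diff: "mult_op f \<Longrightarrow> mult_op g \<Longrightarrow> mult_op (\<lambda>x. f x - g x)"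
  using mult_op.add[OF _ mult_op_mult_left[of g "-1"]] by simp

lemma mult_op_sum:
  assumes "finite S" "\<And>s. s \<in> S \<Longrightarrow> mult_op (f s)"
  shows "mult_op (\<lambda>x. \<Sum>s\<in>S. f s x)"
  using assms
proof (induction rule: finite_induct)
  case empty
  show ?case using mult_op.base[of 0 0] by simp
qed (simp add: mult_op.add)

lemma mult_op_plus: "mult_op f \<Longrightarrow> f (x + y) = f x + f y"
  by (induction rule: mult_op.induct) (simp_all add: algebra_simps)

lemma mult_op_zero: "mult_op f \<Longrightarrow> f 0 = 0"
  by (induction rule: mult_op.induct) simp_all

lemma mult_op_sum_arg: "mult_op f \<Longrightarrow> f (\<Sum>i\<in>I. g i) = (\<Sum>i\<in>I. f (g i))"
  by (induction I rule: infinite_finite_induct) (simp_all add: mult_op_plus mult_op_zero)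

definition central :: "'d::monoid_mult \<Rightarrow> bool" where
  "central z \<longleftrightarrow> (\<forall>x. z * x = x * z)"

lemma mult_op_central: "mult_op f \<Longrightarrow> central z \<Longrightarrow> f (z * x) = z * f x"
proof (induction rule: mult_op.induct)
  case (base u w)
  then show ?case by (metis central_def mult.assoc)
qed (simp add: distrib_left)

lemma central_of_center [simp]: "central (of_center c)"
  using of_center[of c] by (simp add: central_def)

lemma of_center_to_center: "central z \<Longrightarrow> of_center (to_center z) = z"
  by (simp add: central_def to_center_inverse)

interpretation center: vector_space center_scale
  by (rule vector_space_center_scale)

text \<open>If no multiplication operator separates \<open>x\<close> from \<open>S\<close>, then
  \<open>g x = (\<Sum>s\<in>S. g s * f s x)\<close> for every multiplication operator \<open>g\<close>; taking
  \<open>g = (\<lambda>y. f t y * b)\<close> shows that the coefficients \<open>f t x\<close> are central.\<close>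

lemma mult_op_separates:
  assumes S: "finite S"
    and f: "\<And>s. s \<in> S \<Longrightarrow> mult_op (f s)"
    and dual: "\<And>s t. s \<in> S \<Longrightarrow> t \<in> S \<Longrightarrow> f s t = (if s = t then 1 else 0)"
    and x: "x \<notin> center.span S"
  shows "\<exists>g. mult_op g \<and> (\<forall>s\<in>S. g s = 0) \<and> g x = 1"
proof (rule ccontr)
  assume neg: "\<not> ?thesis"
  have kill: "g x = 0" if g: "mult_op g" and 0: "\<And>s. s \<in> S \<Longrightarrow> g s = 0" for g
  proof (rule ccontr)
    assume "g x \<noteq> 0"
    then have "mult_op (\<lambda>y. inverse (g x) * g y) \<and> (\<forall>s\<in>S. inverse (g x) * g s = 0) \<and>
      inverse (g x) * g x = 1"
      using g 0 by (simp add: mult_op_mult_left)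
    with neg show False by blast
  qed
  have repr: "g x = (\<Sum>s\<in>S. g s * f s x)" if g: "mult_op g" for g
  proof -
    have "mult_op (\<lambda>y. g y - (\<Sum>s\<in>S. g s * f s y))"
      using S f g by (intro mult_op_diff mult_op_sum mult_op_mult_left) auto
    moreover have "g t - (\<Sum>s\<in>S. g s * f s t) = 0" if "t \<in> S" for t
    proof -
      have "(\<Sum>s\<in>S. g s * f s t) = (\<Sum>s\<in>S. if s = t then g t else 0)"
        by (rule sum.cong) (use dual that in auto)
      then show ?thesis using S that by simp
    qed
    ultimately show ?thesis using kill by fastforce
  qed
  have cen: "central (f t x)" if t: "t \<in> S" for t
    unfolding central_def
  proof
    fix b
    have "f t x * b = (\<Sum>s\<in>S. f t s * b * f s x)"
      using repr[OF mult_op_mult_right[OF f[OF t], of b]] .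
    also have "\<dots> = (\<Sum>s\<in>S. if s = t then b * f t x else 0)"
      by (rule sum.cong) (use dual t in auto)
    finally show "f t x * b = b * f t x" using S t by simp
  qed
  have "x = (\<Sum>s\<in>S. s * f s x)"
    using repr[OF mult_op_id] .
  also have "\<dots> = (\<Sum>s\<in>S. center_scale (to_center (f s x)) s)"
    by (rule sum.cong) (use cen in \<open>auto simp: center_scale_def of_center_to_center central_def\<close>)
  also have "\<dots> \<in> center.span S"
    by (intro center.span_sum center.span_scale center.span_base)
  finally show False using x by simp
qed

text \<open>This is Jacobson density for D as a module over D \<otimes> D^op, whose commutant is the
  center. The dual system grows as in Gram-Schmidt: the operator \<open>g\<close> separating the new
  element \<open>x\<close> from \<open>S\<close> joins the system, and each old operator is
  corrected by a left multiple of \<open>g\<close>, which is invisible on \<open>S\<close>.\<close>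

lemma mult_op_dual:
  assumes "finite S" "center.independent S"
  shows "\<exists>f. (\<forall>s\<in>S. mult_op (f s)) \<and> (\<forall>s\<in>S. \<forall>t\<in>S. f s t = (if s = t then 1 else 0))"
  using assms
proof (induction rule: finite_induct)
  case (insert x S)
  then have ind: "center.independent S" "x \<notin> center.span S"
    by (auto simp: center.independent_insert)
  with insert obtain f where f: "\<forall>s\<in>S. mult_op (f s)"
    "\<forall>s\<in>S. \<forall>t\<in>S. f s t = (if s = t then 1 else 0)" by blast
  obtain g where g: "mult_op g" "\<forall>s\<in>S. g s = 0" "g x = 1"
    using mult_op_separates[OF \<open>finite S\<close> _ _ ind(2), of f] f by auto
  define f' where "f' s = (if s = x then g else (\<lambda>y. f s y - f s x * g y))" for s
  have "\<forall>s\<in>insert x S. mult_op (f' s)"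
    using f g by (auto simp: f'_def intro!: mult_op_diff mult_op_mult_left)
  moreover have "\<forall>s\<in>insert x S. \<forall>t\<in>insert x S. f' s t = (if s = t then 1 else 0)"
    using f g insert by (auto simp: f'_def)
  ultimately show ?case by blast
qed simp

section \<open>Finite purely inseparable extensions\<close>

locale subfield =
  fixes k :: "'k::field set"
  assumes one_closed: "1 \<in> k"
    and diff_closed: "x \<in> k \<Longrightarrow> y \<in> k \<Longrightarrow> x - y \<in> k"
    and mult_closed: "x \<in> k \<Longrightarrow> y \<in> k \<Longrightarrow> x * y \<in> k"
    and inverse_closed: "x \<in> k \<Longrightarrow> inverse x \<in> k"
begin

lemma zero_closed: "0 \<in> k"
  using diff_closed[OF one_closed one_closed] by simp

lemma uminus_closed: "x \<in> k \<Longrightarrow> - x \<in> k"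
  using diff_closed[OF zero_closed] by simp

lemma add_closed: "x \<in> k \<Longrightarrow> y \<in> k \<Longrightarrow> x + y \<in> k"
  using diff_closed[OF _ uminus_closed, of x y] by simp

lemma sum_closed: "(\<And>i. i \<in> I \<Longrightarrow> f i \<in> k) \<Longrightarrow> sum f I \<in> k"
  by (induction I rule: infinite_finite_induct) (auto intro: zero_closed add_closed)

lemma of_nat_closed: "of_nat n \<in> k"
  by (induction n) (auto intro: zero_closed one_closed add_closed)

end

text \<open>The scalars form a set and not a type because the intermediate fields of a tower arise
  in the course of a proof. Sums over infinite sets are 0, so this is the linear span only for
  finite \<open>S\<close>.\<close>

definition lin_span :: "'k::field set \<Rightarrow> 'k set \<Rightarrow> 'k set" where
  "lin_span k S = {\<Sum>s\<in>S. c s * s | c. \<forall>s\<in>S. c s \<in> k}"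

definition lin_free :: "'k::field set \<Rightarrow> 'k set \<Rightarrow> bool" where
  "lin_free k S \<longleftrightarrow>
     (\<forall>c. (\<forall>s\<in>S. c s \<in> k) \<and> (\<Sum>s\<in>S. c s * s) = 0 \<longrightarrow> (\<forall>s\<in>S. c s = 0))"

text \<open>X - \<alpha> is prime, so at each step of the induction one factor cancels either
  against \<open>g\<close> or against its cofactor. This identifies a minimal polynomial that
  divides (X - \<alpha>)^p.\<close>

lemma dvd_linear_power:
  fixes g :: "'k::field poly"
  assumes "g dvd [:- \<alpha>, 1:] ^ n"
  shows "\<exists>c j. g = smult c ([:- \<alpha>, 1:] ^ j)"
  using assms
proof (induction n arbitrary: g)
  case 0
  then show ?case
    by (metis dvd_def is_unit_poly_iff power_0 smult_one one_pCons smult_pCons smult_0_right mult.right_neutral)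
next
  case (Suc n)
  let ?l = "[:- \<alpha>, 1:]"
  from Suc.prems obtain q where q: "?l ^ Suc n = g * q" by (elim dvdE)
  show ?case
  proof (cases "poly g \<alpha> = 0")
    case True
    then obtain g1 where g1: "g = ?l * g1"
      by (auto simp: poly_eq_0_iff_dvd elim: dvdE)
    with q have "?l * ?l ^ n = ?l * (g1 * q)" by (simp only: mult.assoc power_Suc)
    then have "?l ^ n = g1 * q" by (simp only: mult_cancel_left) simp
    then obtain c j where "g1 = smult c (?l ^ j)" using Suc.IH[of g1] by auto
    with g1 have "g = smult c (?l ^ Suc j)" by simp
    then show ?thesis by blast
  next
    case False
    have "poly (g * q) \<alpha> = 0" unfolding q[symmetric] by simp
    with False have "poly q \<alpha> = 0" by simp
    then obtain q1 where q1: "q = ?l * q1"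
      by (auto simp: poly_eq_0_iff_dvd elim: dvdE)
    with q have "?l * ?l ^ n = ?l * (g * q1)" by (simp only: mult.left_commute power_Suc)
    then have "?l ^ n = g * q1" by (simp only: mult_cancel_left) simp
    then show ?thesis using Suc.IH[of g] by auto
  qed
qed

section \<open>Adjoining p-th roots\<close>

context subfield
begin

text \<open>Polynomials over \<open>k\<close> are polynomials over the big field with restricted
  coefficients. Division by \<open>g\<close> removes one leading term at a time, which makes it
  visible that the remainders keep their coefficients in \<open>k\<close>.\<close>

lemma minimal_poly_dvd:
  fixes g :: "'k poly"
  assumes g: "\<And>i. coeff g i \<in> k" "poly g \<alpha> = 0" "g \<noteq> 0"
    and min: "\<And>q. (\<And>i. coeff q i \<in> k) \<Longrightarrow> poly q \<alpha> = 0 \<Longrightarrow> degree q < degree g \<Longrightarrow> q = 0"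
    and f: "\<And>i. coeff f i \<in> k" "poly f \<alpha> = 0"
  shows "g dvd f"
  using f
proof (induction "degree f" arbitrary: f rule: less_induct)
  case less
  show ?case
  proof (cases "degree f < degree g")
    case True
    then have "f = 0" by (rule min[OF less.prems])
    then show ?thesis by simp
  next
    case False
    define m where "m = monom (lead_coeff f * inverse (lead_coeff g)) (degree f - degree g)"
    define f' where "f' = f - m * g"
    have m: "coeff m i \<in> k" for i
      using less.prems(1) g(1) by (auto simp: m_def zero_closed intro: mult_closed inverse_closed)
    have "coeff f' i \<in> k" for i
      unfolding f'_def coeff_diff coeff_mult
      by (intro diff_closed sum_closed mult_closed m g(1) less.prems(1))
    moreover have "poly f' \<alpha> = 0" by (simp add: f'_def less.prems g)
    moreover have "f' = 0 \<or> degree f' < degree f"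
    proof (rule eq_zero_or_degree_less)
      have "degree (m * g) \<le> degree m + degree g" by (rule degree_mult_le)
      also have "\<dots> \<le> degree f - degree g + degree g"
        unfolding m_def by (intro add_mono degree_monom_le order_refl)
      finally show "degree f' \<le> degree f"
        using False by (simp add: f'_def degree_diff_le)
      show "coeff f' (degree f) = 0"
        using False g(3) coeff_monom_mult[of "lead_coeff f * inverse (lead_coeff g)"
            "degree f - degree g" g "degree f"]
        by (simp add: f'_def m_def)
    qed
    ultimately have "g dvd f'"
      using less.hyps[of f'] by auto
    moreover have "f = f' + m * g" by (simp add: f'_def)
    ultimately show ?thesis by (metis dvd_add dvd_triv_right)
  qed
qed

text \<open>A relation would give a minimal polynomial \<open>g\<close> of degree j < p over
  \<open>k\<close>. It divides X^p - \<alpha>^p = (X - \<alpha>)^p, hence is a multiple of (X -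
  \<alpha>)^j. As j < p, its derivative is nonzero, so by minimality the derivative does not vanish
  at \<alpha>. Thus j = 1, and the coefficients of \<open>g\<close> put \<alpha> into
  \<open>k\<close>.\<close>

lemma powers_independent:
  assumes p: "prime p" "CHAR('k) = p"
    and \<alpha>: "\<alpha> \<notin> k" "\<alpha> ^ p \<in> k"
    and l: "\<And>i. i < p \<Longrightarrow> l i \<in> k" and sum0: "(\<Sum>i<p. l i * \<alpha> ^ i) = 0"
    and "i < p"
  shows "l i = 0"
proof (rule ccontr)
  assume "l i \<noteq> 0"
  define P where "P q \<longleftrightarrow> q \<noteq> 0 \<and> (\<forall>i. coeff q i \<in> k) \<and> poly q \<alpha> = 0" for q
  define q0 where "q0 = (\<Sum>i<p. monom (l i) i)"
  have c0: "coeff q0 j = (if j < p then l j else 0)" for j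
    by (auto simp: q0_def coeff_sum)
  have "degree q0 < p"
    using c0 \<open>i < p\<close> by (metis leading_coeff_0_iff degree_0 not_gr_zero less_nat_zero_code)
  moreover have "P q0"
  proof -
    have "coeff q0 i \<noteq> 0" using \<open>l i \<noteq> 0\<close> \<open>i < p\<close> c0 by simp
    then have "q0 \<noteq> 0" by (metis coeff_0)
    moreover have "poly q0 \<alpha> = 0" using sum0 by (simp add: q0_def poly_sum poly_monom)
    ultimately show ?thesis using l by (simp add: P_def c0 zero_closed)
  qed
  moreover obtain g where g: "P g" "\<And>q. P q \<Longrightarrow> degree g \<le> degree q"
    using \<open>P q0\<close> by (metis ex_has_least_nat)
  ultimately have dg: "degree g < p" using le_less_trans by blast
  have min: "q = 0" if "\<And>i. coeff q i \<in> k" "poly q \<alpha> = 0" "degree q < degree g" for q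
    using g(2)[of q] that unfolding P_def by fastforce
  let ?l = "[:- \<alpha>, 1:]"
  have "?l ^ p = (monom 1 1 + [:- \<alpha>:]) ^ p" by (simp add: monom_altdef)
  also have "\<dots> = monom 1 1 ^ p + [:- \<alpha>:] ^ p"
    by (rule freshmans_dream) (use p in simp_all)
  also have "\<dots> = monom 1 p + [:(- \<alpha>) ^ p:]" by (simp add: monom_power poly_const_pow)
  finally have lp: "?l ^ p = monom 1 p + [:(- \<alpha>) ^ p:]" .
  have "(- \<alpha>) ^ p \<in> k" using \<alpha>(2) uminus_closed by (cases "even p") auto
  then have "coeff (?l ^ p) j \<in> k" for j
    using prime_gt_0_nat[OF p(1)]
    by (auto simp: lp one_closed zero_closed coeff_pCons split: nat.split intro!: add_closed)
  moreover have "poly (?l ^ p) \<alpha> = 0" using prime_gt_0_nat[OF p(1)] by simp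
  ultimately have "g dvd ?l ^ p"
    using g(1) min by (intro minimal_poly_dvd) (auto simp: P_def)
  then obtain c j where gc: "g = smult c (?l ^ j)" using dvd_linear_power by blast
  have "c \<noteq> 0" using g(1) gc by (auto simp: P_def)
  then have dj: "degree g = j" by (simp add: gc degree_linear_power)
  have j0: "j > 0" using g(1) gc \<open>c \<noteq> 0\<close> by (cases j) (auto simp: P_def)
  have "coeff (pderiv g) (j - 1) = of_nat j * lead_coeff g"
    using j0 dj by (simp add: coeff_pderiv)
  moreover have "of_nat j \<noteq> (0::'k)"
    using j0 dg dj p by (simp add: of_nat_eq_0_iff_char_dvd nat_dvd_not_less)
  ultimately have nz: "pderiv g \<noteq> 0" using g(1) by (auto simp: P_def)
  have "coeff (pderiv g) i \<in> k" for i
    using g(1) unfolding coeff_pderiv P_def by (blast intro: mult_closed of_nat_closed)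
  then have "poly (pderiv g) \<alpha> \<noteq> 0"
  proof -
    have "degree (pderiv g) \<le> j - 1"
      by (rule degree_le) (auto simp: coeff_pderiv coeff_eq_0 dj)
    then show ?thesis
      using min[of "pderiv g"] nz j0 dj \<open>\<And>i. coeff (pderiv g) i \<in> k\<close> by fastforce
  qed
  then have "j = 1"
  proof -
    obtain i where i: "j = Suc i" using j0 by (cases j) auto
    show ?thesis
      using \<open>poly (pderiv g) \<alpha> \<noteq> 0\<close> unfolding gc i pderiv_smult pderiv_power_Suc
      by (cases i) simp_all
  qed
  then have "coeff g 0 = - c * \<alpha>" "coeff g 1 = c" by (simp_all add: gc)
  then have "- c * \<alpha> \<in> k" "c \<in> k" using g(1) by (metis P_def)+
  then have "inverse c * (- (- c * \<alpha>)) \<in> k"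
    using mult_closed[OF inverse_closed uminus_closed] by blast
  moreover have "inverse c * (- (- c * \<alpha>)) = \<alpha>"
    using \<open>c \<noteq> 0\<close> by (simp add: mult.assoc[symmetric])
  ultimately have "\<alpha> \<in> k" by (simp only:)
  then show False using \<alpha>(1) by contradiction
qed

text \<open>The basis of a tower comes as a family of products, whereas \<open>lin_free\<close>
  speaks of sets. A collision in the family would itself be a relation, with coefficients 1 and -1,
  so freeness of the family already excludes it.\<close>

lemma inj_on_lin_free_image:
  assumes I: "finite I"
    and free: "\<And>c. (\<And>x. x \<in> I \<Longrightarrow> c x \<in> k) \<Longrightarrow> (\<Sum>x\<in>I. c x * f x) = 0 \<Longrightarrow> (\<forall>x\<in>I. c x = 0)"
  shows "inj_on f I" "lin_free k (f ` I)"
proof -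
  show inj: "inj_on f I"
  proof (rule inj_onI, rule ccontr)
    fix x y assume xy: "x \<in> I" "y \<in> I" "f x = f y" "x \<noteq> y"
    let ?c = "\<lambda>z. (if z = x then 1 else 0) - (if z = y then 1 else (0::'k))"
    have "(\<Sum>z\<in>I. ?c z * f z) = (\<Sum>z\<in>I. if z = x then f x else 0) - (\<Sum>z\<in>I. if z = y then f y else 0)"
      unfolding sum_subtractf[symmetric] by (rule sum.cong) auto
    then have "(\<Sum>z\<in>I. ?c z * f z) = 0" using I xy by simp
    moreover have "?c z \<in> k" for z
      by (auto intro: uminus_closed one_closed zero_closed)
    ultimately have "\<forall>z\<in>I. ?c z = 0" using free[of ?c] by blast
    then have "?c x = 0" using xy by blast
    then show False using xy by simp
  qed
  show "lin_free k (f ` I)"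
    unfolding lin_free_def
  proof (intro allI impI, elim conjE)
    fix c assume "\<forall>s\<in>f ` I. c s \<in> k" "(\<Sum>s\<in>f ` I. c s * s) = 0"
    then show "\<forall>s\<in>f ` I. c s = 0"
      using free[of "c \<circ> f"] by (simp add: sum.reindex[OF inj])
  qed
qed

lemma lin_span_image:
  assumes "inj_on f I"
  shows "lin_span k (f ` I) = {\<Sum>x\<in>I. c x * f x | c. \<forall>x\<in>I. c x \<in> k}"
proof (intro equalityI subsetI)
  fix y assume "y \<in> lin_span k (f ` I)"
  then obtain c where "\<forall>s\<in>f ` I. c s \<in> k" "y = (\<Sum>s\<in>f ` I. c s * s)"
    by (auto simp: lin_span_def)
  then show "y \<in> {\<Sum>x\<in>I. c x * f x | c. \<forall>x\<in>I. c x \<in> k}"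
    by (auto simp: sum.reindex[OF assms] intro!: exI[of _ "c \<circ> f"])
next
  fix y assume "y \<in> {\<Sum>x\<in>I. c x * f x | c. \<forall>x\<in>I. c x \<in> k}"
  then obtain c where c: "\<forall>x\<in>I. c x \<in> k" "y = (\<Sum>x\<in>I. c x * f x)" by auto
  have "(\<Sum>s\<in>f ` I. c (the_inv_into I f s) * s) = y"
    unfolding c(2) sum.reindex[OF assms]
    by (rule sum.cong) (simp_all add: the_inv_into_f_f[OF assms])
  moreover have "\<forall>s\<in>f ` I. c (the_inv_into I f s) \<in> k"
    using c(1) by (auto simp: the_inv_into_f_f[OF assms])
  ultimately show "y \<in> lin_span k (f ` I)"
    unfolding lin_span_def
    by (intro CollectI exI[of _ "\<lambda>s. c (the_inv_into I f s)"]) simp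
qed

text \<open>Closure under inverses comes from pure inseparability: if x^N lies in \<open>k\<close>
  for N = p^e, then the inverse of x is x^(N-1) divided by x^N, and only ring operations and
  inverses in \<open>k\<close> occur.\<close>

lemma adjoin_subfield:
  assumes p: "p > 0"
    and insep: "\<And>x. \<exists>e. x ^ (p ^ e) \<in> k"
    and \<alpha>: "\<alpha> ^ p \<in> k"
  shows "subfield {\<Sum>i<p. l i * \<alpha> ^ i | l. \<forall>i<p. l i \<in> k}" (is "subfield ?M")
    and "k \<subseteq> {\<Sum>i<p. l i * \<alpha> ^ i | l. \<forall>i<p. l i \<in> k}"
proof -
  have MI: "(\<Sum>i<p. l i * \<alpha> ^ i) \<in> ?M" if "\<And>i. i < p \<Longrightarrow> l i \<in> k" for l
    using that by blast
  obtain m where m: "p = Suc m" using p by (cases p) auto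
  show kM: "k \<subseteq> ?M"
  proof
    fix x assume "x \<in> k"
    then have "(\<Sum>i<p. (if i = 0 then x else 0) * \<alpha> ^ i) \<in> ?M"
      by (intro MI) (auto simp: zero_closed)
    moreover have "(\<Sum>i<p. (if i = 0 then x else 0) * \<alpha> ^ i) = x"
      unfolding m sum.lessThan_Suc_shift by simp
    ultimately show "x \<in> ?M" by simp
  qed
  have M_diff: "x - y \<in> ?M" if x: "x \<in> ?M" and y: "y \<in> ?M" for x y
  proof -
    obtain a where a: "\<forall>i<p. a i \<in> k" "x = (\<Sum>i<p. a i * \<alpha> ^ i)" using x by blast
    obtain b where b: "\<forall>i<p. b i \<in> k" "y = (\<Sum>i<p. b i * \<alpha> ^ i)" using y by blast
    have "(\<Sum>i<p. (a i - b i) * \<alpha> ^ i) \<in> ?M"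
      using a b by (intro MI diff_closed) auto
    then show ?thesis by (simp add: a b left_diff_distrib sum_subtractf)
  qed
  have M_0: "0 \<in> ?M" using kM zero_closed by blast
  have M_add: "x + y \<in> ?M" if "x \<in> ?M" "y \<in> ?M" for x y
    using M_diff[OF that(1) M_diff[OF M_0 that(2)]] by simp
  have M_sum: "sum f I \<in> ?M" if "\<And>i. i \<in> I \<Longrightarrow> f i \<in> ?M" for f :: "nat \<Rightarrow> 'k" and I
    using that
  proof (induction I rule: infinite_finite_induct)
    case (insert j J)
    have "f j + sum f J \<in> ?M" by (intro M_add insert) auto
    then show ?case unfolding sum.insert[OF insert.hyps] .
  qed (use M_0 in simp_all)
  have M_scale: "c * x \<in> ?M" if c: "c \<in> k" and x: "x \<in> ?M" for c x
  proof -
    obtain a where a: "\<forall>i<p. a i \<in> k" "x = (\<Sum>i<p. a i * \<alpha> ^ i)" using x by blast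
    have "(\<Sum>i<p. (c * a i) * \<alpha> ^ i) \<in> ?M"
      using a c by (intro MI mult_closed) auto
    then show ?thesis by (simp add: a sum_distrib_left mult.assoc)
  qed
  have M_\<alpha>: "\<alpha> * x \<in> ?M" if x: "x \<in> ?M" for x
  proof -
    obtain a where a: "\<forall>i<p. a i \<in> k" "x = (\<Sum>i<p. a i * \<alpha> ^ i)" using x by blast
    \<comment> \<open>Multiplication by \<alpha> shifts the coefficients; the top one wraps around
      to index 0 and picks up the scalar \<alpha>^p.\<close>
    define b where "b i = (case i of 0 \<Rightarrow> a m * \<alpha> ^ p | Suc j \<Rightarrow> a j)" for i
    have "(\<Sum>i<p. b i * \<alpha> ^ i) \<in> ?M"
      using a \<alpha> m by (intro MI) (auto simp: b_def intro: mult_closed split: nat.split)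
    moreover have "(\<Sum>i<p. b i * \<alpha> ^ i) = \<alpha> * x"
    proof -
      have "(\<Sum>i<p. b i * \<alpha> ^ i) = a m * \<alpha> ^ p + (\<Sum>i<m. a i * \<alpha> ^ Suc i)"
        by (subst m, subst sum.lessThan_Suc_shift) (simp add: b_def)
      also have "\<dots> = \<alpha> * x"
        unfolding a(2) m by (simp add: sum_distrib_left algebra_simps)
      finally show ?thesis .
    qed
    ultimately show ?thesis by simp
  qed
  have M_\<alpha>_pow: "\<alpha> ^ i * x \<in> ?M" if "x \<in> ?M" for x i
  proof (induction i)
    case (Suc i)
    then show ?case using M_\<alpha>[OF Suc] by (simp add: mult.assoc)
  qed (use that in simp)
  have M_mult: "x * y \<in> ?M" if x: "x \<in> ?M" and y: "y \<in> ?M" for x y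
  proof -
    obtain a where a: "\<forall>i<p. a i \<in> k" "x = (\<Sum>i<p. a i * \<alpha> ^ i)" using x by blast
    have "(\<Sum>i<p. a i * (\<alpha> ^ i * y)) \<in> ?M"
      by (intro M_sum M_scale M_\<alpha>_pow y) (use a in auto)
    then show ?thesis by (simp add: a sum_distrib_right mult.assoc)
  qed
  show "subfield ?M"
  proof
    show "1 \<in> ?M" by (rule subsetD[OF kM one_closed])
    fix x assume x: "x \<in> ?M"
    obtain e where e: "x ^ (p ^ e) \<in> k" using insep by blast
    have pow: "x ^ n \<in> ?M" for n
    proof (induction n)
      case 0 show ?case unfolding power_0 by (rule subsetD[OF kM one_closed])
    next
      case (Suc n) show ?case using M_mult[OF x Suc] by simp
    qed
    show "inverse x \<in> ?M"
    proof (cases "x = 0")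
      case False
      obtain n where n: "p ^ e = Suc n" using p by (metis gr0_implies_Suc zero_less_power)
      have "inverse (x ^ (p ^ e)) * x ^ n \<in> ?M"
        using M_scale[OF inverse_closed[OF e] pow] .
      moreover have "inverse (x ^ (p ^ e)) * x ^ n = inverse x"
        using False unfolding n by (simp add: field_simps)
      ultimately show ?thesis by simp
    qed (use M_0 in simp)
  qed (use M_diff M_mult in blast)+
qed

text \<open>The tower law: the products of a basis of the intermediate field with 1, \<alpha>, ...,
  \<alpha>^(p-1) form a basis of the next field. Independence of the powers is used over the
  intermediate field, that of \<open>S\<close> over \<open>k\<close>.\<close>

lemma adjoin_p_th_root:
  assumes p: "prime p" "CHAR('k) = p"
    and insep: "\<And>x. \<exists>e. x ^ (p ^ e) \<in> k"
    and S: "finite S" "lin_free k S" "subfield (lin_span k S)" "k \<subseteq> lin_span k S"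
    and \<alpha>: "\<alpha> \<notin> lin_span k S" "\<alpha> ^ p \<in> lin_span k S"
  shows "\<exists>S'. finite S' \<and> card S' = card S * p \<and> lin_free k S' \<and> subfield (lin_span k S') \<and>
    k \<subseteq> lin_span k S'"
proof -
  interpret L: subfield "lin_span k S" by fact
  let ?L = "lin_span k S"
  define f where "f = (\<lambda>(s, i). s * \<alpha> ^ i)"
  define I where "I = S \<times> {..<p}"
  have I: "finite I" using S by (simp add: I_def)
  have expand: "(\<Sum>x\<in>I. c x * f x) = (\<Sum>i<p. (\<Sum>s\<in>S. c (s, i) * s) * \<alpha> ^ i)" for c
    unfolding I_def f_def sum_distrib_right
    by (subst sum.swap, subst sum.cartesian_product) (simp add: split_def mult.assoc)
  have free: "\<forall>x\<in>I. c x = 0" if c: "\<And>x. x \<in> I \<Longrightarrow> c x \<in> k" and 0: "(\<Sum>x\<in>I. c x * f x) = 0" for c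
  proof -
    have "(\<Sum>s\<in>S. c (s, i) * s) = 0" if "i < p" for i
    proof (rule L.powers_independent[OF p \<alpha> _ _ that])
      show "(\<Sum>s\<in>S. c (s, i) * s) \<in> ?L" if "i < p" for i
        using c that by (force simp: lin_span_def I_def)
      show "(\<Sum>i<p. (\<Sum>s\<in>S. c (s, i) * s) * \<alpha> ^ i) = 0" using 0 expand by simp
    qed
    then show ?thesis
      using S(2) c unfolding lin_free_def I_def by fastforce
  qed
  note im = inj_on_lin_free_image[of I f, OF I free, simplified]
  let ?M = "{\<Sum>i<p. l i * \<alpha> ^ i | l. \<forall>i<p. l i \<in> ?L}"
  have "lin_span k (f ` I) = ?M"
  proof (intro equalityI subsetI)
    fix y assume "y \<in> lin_span k (f ` I)"
    then obtain c where "\<forall>x\<in>I. c x \<in> k" "y = (\<Sum>x\<in>I. c x * f x)"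
      unfolding lin_span_image[OF im(1)] by blast
    then show "y \<in> ?M" unfolding expand
      by (intro CollectI exI[of _ "\<lambda>i. \<Sum>s\<in>S. c (s, i) * s"]) (force simp: lin_span_def I_def)
  next
    fix y assume "y \<in> ?M"
    then obtain l where l: "\<forall>i<p. l i \<in> ?L" "y = (\<Sum>i<p. l i * \<alpha> ^ i)" by blast
    then have "\<forall>i. \<exists>c. i < p \<longrightarrow> (\<forall>s\<in>S. c s \<in> k) \<and> l i = (\<Sum>s\<in>S. c s * s)"
      by (force simp: lin_span_def)
    then obtain c where c: "\<And>i. i < p \<Longrightarrow> (\<forall>s\<in>S. c i s \<in> k) \<and> l i = (\<Sum>s\<in>S. c i s * s)"
      by metis
    have "y = (\<Sum>x\<in>I. (case x of (s, i) \<Rightarrow> c i s) * f x)"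
      unfolding expand l(2) by (rule sum.cong) (use c in auto)
    moreover have "\<forall>x\<in>I. (case x of (s, i) \<Rightarrow> c i s) \<in> k" using c by (auto simp: I_def)
    ultimately show "y \<in> lin_span k (f ` I)"
      unfolding lin_span_image[OF im(1)] by blast
  qed
  moreover have "subfield ?M" "?L \<subseteq> ?M"
    using L.adjoin_subfield[OF prime_gt_0_nat[OF p(1)] _ \<alpha>(2)] insep S(4) by blast+
  moreover have "card (f ` I) = card S * p"
    by (simp add: card_image[OF im(1)]) (simp add: I_def card_cartesian_product)
  ultimately show ?thesis
    using im I S(4) by (intro exI[of _ "f ` I"]) auto
qed

text \<open>Among the intermediate fields of degree p^e take one with e maximal; e is bounded
  because e < p^e \<le> n. If some x lay outside, the last of its iterated p-th powers still outside
  would be an element whose p-th power is inside, and adjoining it would contradict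
  maximality.\<close>

lemma purely_inseparable_basis:
  assumes p: "prime p" "CHAR('k) = p"
    and insep: "\<And>x. \<exists>e. x ^ (p ^ e) \<in> k"
    and bound: "\<And>S. finite S \<Longrightarrow> lin_free k S \<Longrightarrow> card S \<le> n"
  shows "\<exists>S e. finite S \<and> card S = p ^ e \<and> lin_free k S \<and> lin_span k S = UNIV"
proof -
  define P where "P e \<longleftrightarrow> (\<exists>S. finite S \<and> card S = p ^ e \<and> lin_free k S \<and>
    subfield (lin_span k S) \<and> k \<subseteq> lin_span k S)" for e
  have "lin_span k {1} = k" by (auto simp: lin_span_def)
  moreover have "lin_free k {1}" by (auto simp: lin_free_def)
  ultimately have "P 0"
    unfolding P_def using subfield_axioms by (intro exI[of _ "{1}"]) auto
  moreover have "e \<le> n" if "P e" for e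
  proof -
    have "e < p ^ e" using prime_gt_1_nat[OF p(1)] by (simp add: power_gt_expt)
    also have "p ^ e \<le> n" using that bound unfolding P_def by fastforce
    finally show ?thesis by simp
  qed
  ultimately obtain e where e: "P e" "\<And>e'. P e' \<Longrightarrow> e' \<le> e"
    using Greatest_le_nat[of P _ n] GreatestI_nat[of P 0 n] by blast
  then obtain S where S: "finite S" "card S = p ^ e" "lin_free k S" "subfield (lin_span k S)"
    "k \<subseteq> lin_span k S"
    unfolding P_def by blast
  have "lin_span k S = UNIV"
  proof (rule ccontr)
    assume "lin_span k S \<noteq> UNIV"
    then obtain x where x: "x \<notin> lin_span k S" by blast
    define j where "j = (LEAST j. x ^ (p ^ j) \<in> lin_span k S)"
    have j: "x ^ (p ^ j) \<in> lin_span k S"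
      using insep[of x] S(5) unfolding j_def by (meson LeastI subsetD)
    then obtain i where i: "j = Suc i" using x by (cases j) auto
    then have "x ^ (p ^ i) \<notin> lin_span k S"
      unfolding j_def by (metis lessI not_less_Least)
    moreover have "(x ^ (p ^ i)) ^ p \<in> lin_span k S"
      using j unfolding i by (simp add: power_mult[symmetric] mult.commute)
    ultimately have "P (Suc e)"
      using adjoin_p_th_root[OF p insep S(1,3,4,5)] S(2) unfolding P_def by (simp add: mult.commute)
    then show False using e(2) by fastforce
  qed
  with S show ?thesis by blast
qed

end

section \<open>Division rings with a central uniformizer\<close>

text \<open>\<open>\<rho>\<close> is a total function whose values outside \<open>V\<close> are
  unconstrained. Axiom \<open>\<rho>_ker\<close> contains both that \<open>V\<close> is stable under
  \<open>h\<close> and that V/hV embeds into the residue field. As that field is commutative,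
  commutators of elements of \<open>V\<close> lie in hV. By \<open>absorb\<close> the elements of D
  are those of \<open>V\<close> divided by powers of \<open>h\<close>, and \<open>separated\<close>
  says that the h-adic topology is Hausdorff.\<close>

locale central_place =
  fixes V :: "'d::division_ring set" and h :: 'd and \<rho> :: "'d \<Rightarrow> 'k::field"
  assumes one_V: "1 \<in> V"
    and diff_V: "x \<in> V \<Longrightarrow> y \<in> V \<Longrightarrow> x - y \<in> V"
    and mult_V: "x \<in> V \<Longrightarrow> y \<in> V \<Longrightarrow> x * y \<in> V"
    and h_central: "central h"
    and h_nz: "h \<noteq> 0"
    and \<rho>_diff: "x \<in> V \<Longrightarrow> y \<in> V \<Longrightarrow> \<rho> (x - y) = \<rho> x - \<rho> y"
    and \<rho>_mult: "x \<in> V \<Longrightarrow> y \<in> V \<Longrightarrow> \<rho> (x * y) = \<rho> x * \<rho> y"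
    and \<rho>_one: "\<rho> 1 = 1"
    and \<rho>_surj: "\<exists>x\<in>V. \<rho> x = c"
    and \<rho>_ker: "x \<in> V \<and> \<rho> x = 0 \<longleftrightarrow> (\<exists>y\<in>V. x = h * y)"
    and absorb: "\<exists>n. h ^ n * x \<in> V"
    and separated: "(\<And>n. \<exists>y\<in>V. x = h ^ n * y) \<Longrightarrow> x = 0"
begin

lemma zero_V: "0 \<in> V" and \<rho>_zero: "\<rho> 0 = 0"
  using diff_V[OF one_V one_V] \<rho>_diff[OF one_V one_V] by auto

lemma uminus_V: "x \<in> V \<Longrightarrow> - x \<in> V" and \<rho>_uminus: "x \<in> V \<Longrightarrow> \<rho> (- x) = - \<rho> x"
  using diff_V[OF zero_V, of x] \<rho>_diff[OF zero_V, of x] by (auto simp: \<rho>_zero)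

lemma add_V: "x \<in> V \<Longrightarrow> y \<in> V \<Longrightarrow> x + y \<in> V"
  and \<rho>_add: "x \<in> V \<Longrightarrow> y \<in> V \<Longrightarrow> \<rho> (x + y) = \<rho> x + \<rho> y"
  using diff_V[OF _ uminus_V, of x y] \<rho>_diff[OF _ uminus_V, of x y] by (auto simp: \<rho>_uminus)

lemma power_V: "x \<in> V \<Longrightarrow> x ^ n \<in> V" and \<rho>_power: "x \<in> V \<Longrightarrow> \<rho> (x ^ n) = \<rho> x ^ n"
  by (induction n) (auto simp: one_V mult_V \<rho>_one \<rho>_mult)

lemma sum_V: "(\<And>i. i \<in> I \<Longrightarrow> f i \<in> V) \<Longrightarrow> sum f I \<in> V"
  by (induction I rule: infinite_finite_induct) (auto simp: zero_V add_V)

lemma \<rho>_sum: "(\<And>i. i \<in> I \<Longrightarrow> f i \<in> V) \<Longrightarrow> \<rho> (sum f I) = (\<Sum>i\<in>I. \<rho> (f i))"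
  by (induction I rule: infinite_finite_induct) (auto simp: \<rho>_zero \<rho>_add sum_V)

lemma h_V: "h \<in> V" and \<rho>_h: "\<rho> h = 0"
  using \<rho>_ker[of h] one_V by force+

section \<open>The h-adic filtration\<close>

lemma central_h_power: "central (h ^ n)"
  using h_central by (simp add: central_def power_commuting_commutes)

lemma h_power_left_commute: "x * (h ^ n * y) = h ^ n * (x * y)"
  by (metis central_def central_h_power mult.assoc)

text \<open>Only nonnegative levels exist. That a map loses at most n levels is therefore expressed
  by multiplying its values by \<open>h ^ n\<close>.\<close>

definition lev :: "nat \<Rightarrow> 'd set" where
  "lev n = {h ^ n * y | y. y \<in> V}"

lemma lev_0: "lev 0 = V"
  by (simp add: lev_def)

lemma levI: "y \<in> V \<Longrightarrow> h ^ n * y \<in> lev n"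
  by (auto simp: lev_def)

lemma lev_shift: "h ^ m * x \<in> lev (m + n) \<longleftrightarrow> x \<in> lev n"
  by (auto simp: lev_def power_add mult.assoc h_nz)

lemma lev_cancel: "h ^ m * x \<in> lev m \<longleftrightarrow> x \<in> V"
  using lev_shift[of m x 0] by (simp add: lev_0)

lemma lev_Suc_subset: "lev (Suc n) \<subseteq> lev n"
proof
  fix x assume "x \<in> lev (Suc n)"
  then obtain y where "y \<in> V" "x = h ^ Suc n * y" by (auto simp: lev_def)
  then have "x = h ^ n * (h * y)" "h * y \<in> V"
    by (simp_all add: mult.assoc power_Suc2 mult_V h_V del: power_Suc)
  then show "x \<in> lev n" by (auto simp: lev_def)
qed

lemma lev_antimono: "m \<le> n \<Longrightarrow> lev n \<subseteq> lev m"
  using lev_Suc_subset by (rule lift_Suc_antimono_le[where f = lev])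

lemma lev_zero: "0 \<in> lev n"
  using levI[OF zero_V, of n] by simp

lemma lev_add: "x \<in> lev n \<Longrightarrow> y \<in> lev n \<Longrightarrow> x + y \<in> lev n"
  by (auto simp: lev_def) (metis add_V distrib_left)

lemma lev_sum: "(\<And>i. i \<in> I \<Longrightarrow> f i \<in> lev n) \<Longrightarrow> sum f I \<in> lev n"
  by (induction I rule: infinite_finite_induct) (auto simp: lev_zero lev_add)

lemma lev_mult: "x \<in> lev m \<Longrightarrow> y \<in> lev n \<Longrightarrow> x * y \<in> lev (m + n)"
proof -
  assume "x \<in> lev m" "y \<in> lev n"
  then obtain a b where ab: "a \<in> V" "b \<in> V" "x = h ^ m * a" "y = h ^ n * b"
    by (auto simp: lev_def)
  then have "x * y = h ^ (m + n) * (a * b)"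
    by (simp add: power_add mult.assoc h_power_left_commute[of a n b])
  with ab show ?thesis by (simp add: levI mult_V)
qed

lemma lev_mult_V: "x \<in> lev n \<Longrightarrow> y \<in> V \<Longrightarrow> x * y \<in> lev n" "y \<in> V \<Longrightarrow> x \<in> lev n \<Longrightarrow> y * x \<in> lev n"
  using lev_mult[of x n y 0] lev_mult[of y 0 x n] by (simp_all add: lev_0)

lemma lev_1: "x \<in> lev 1 \<longleftrightarrow> x \<in> V \<and> \<rho> x = 0"
  unfolding \<rho>_ker by (auto simp: lev_def)

lemma lev_Suc: "x \<in> V \<Longrightarrow> h ^ n * x \<in> lev (Suc n) \<longleftrightarrow> \<rho> x = 0"
  using lev_shift[of n x 1] lev_1 by simp

lemma lev_separated: "(\<And>n. x \<in> lev n) \<Longrightarrow> x = 0"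
  by (rule separated) (auto simp: lev_def)

lemma h_power_notin_lev: "h ^ n \<notin> lev (Suc n)"
  using lev_Suc[OF one_V, of n] \<rho>_one by simp

lemma absorb_ge: "\<exists>n. \<forall>m\<ge>n. h ^ m * x \<in> V"
proof -
  obtain n where n: "h ^ n * x \<in> V" using absorb by blast
  have "h ^ m * x \<in> V" if "m \<ge> n" for m
    using mult_V[OF power_V[OF h_V, of "m - n"] n] that
    by (simp add: mult.assoc[symmetric] power_add[symmetric])
  then show ?thesis by blast
qed

lemma absorb_finite:
  assumes "finite I"
  shows "\<exists>n. \<forall>i\<in>I. h ^ n * f i \<in> V"
proof -
  have "\<forall>i. \<exists>n. \<forall>m\<ge>n. h ^ m * f i \<in> V" using absorb_ge by blast
  then obtain n where "\<And>i. \<forall>m\<ge>n i. h ^ m * f i \<in> V" by metis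
  then have "\<forall>i\<in>I. h ^ (\<Sum>i\<in>I. n i) * f i \<in> V"
    using assms by (meson member_le_sum zero_le)
  then show ?thesis by blast
qed

text \<open>Clearing denominators by \<open>h ^ n\<close> and then dividing by the largest common
  power \<open>h ^ l\<close> makes the family primitive; the inverse is there because n - l may be
  negative. Applied to the coefficients of a relation over the center, it yields a relation over the
  residues that is still nontrivial.\<close>

lemma scale_to_unit:
  assumes I: "finite I" and nz: "i \<in> I" "f i \<noteq> 0"
  shows "\<exists>z. central z \<and> (\<forall>i\<in>I. z * f i \<in> V) \<and> (\<exists>i\<in>I. \<rho> (z * f i) \<noteq> 0)"
proof -
  obtain n where n: "\<forall>i\<in>I. h ^ n * f i \<in> V" using absorb_finite[OF I] by blast
  have "h ^ n * f i \<noteq> 0" using nz h_nz by simp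
  then obtain m0 where "h ^ n * f i \<notin> lev m0" using lev_separated by blast
  then have ex: "\<exists>m. \<not> (\<forall>i\<in>I. h ^ n * f i \<in> lev m)" using nz by blast
  define m where "m = (LEAST m. \<not> (\<forall>i\<in>I. h ^ n * f i \<in> lev m))"
  have m: "\<not> (\<forall>i\<in>I. h ^ n * f i \<in> lev m)"
    unfolding m_def using LeastI_ex[OF ex] .
  then obtain l where l: "m = Suc l" using n lev_0 by (cases m) auto
  have all: "\<forall>i\<in>I. h ^ n * f i \<in> lev l"
    using not_less_Least[of l "\<lambda>m. \<not> (\<forall>i\<in>I. h ^ n * f i \<in> lev m)"] l m_def by auto
  define z where "z = inverse (h ^ l) * h ^ n"
  have hz: "h ^ l * (z * x) = h ^ n * x" for x
    using h_nz by (simp add: z_def mult.assoc[symmetric])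
  have "central (inverse (h ^ l))"
    using central_h_power[of l] unfolding central_def by (metis inverse_central)
  then have "central z"
    using central_h_power[of n] unfolding z_def central_def by (metis mult.assoc)
  moreover have V: "\<forall>i\<in>I. z * f i \<in> V"
    using all lev_cancel[of l] by (metis hz)
  moreover have "\<exists>i\<in>I. \<rho> (z * f i) \<noteq> 0"
    using m V lev_Suc[of _ l] unfolding l by (metis hz)
  ultimately show ?thesis by blast
qed

section \<open>Residues of central elements\<close>

definition residue_center :: "'k set" where
  "residue_center = {\<rho> z | z. z \<in> V \<and> central z}"

text \<open>Take the least n for which \<open>h ^ n\<close> clears the denominator of the inverse.
  If n were positive, the residue of the cleared element times the nonzero \<open>\<rho> x\<close>
  would be \<rho>(h^n) = 0, so another factor \<open>h\<close> could be removed.\<close>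

lemma unit_inverse:
  assumes "x \<in> V" "\<rho> x \<noteq> 0"
  shows "inverse x \<in> V"
proof -
  have "x \<noteq> 0" using assms \<rho>_zero by auto
  obtain n where n: "h ^ n * inverse x \<in> V" "\<forall>m<n. h ^ m * inverse x \<notin> V"
    using absorb[of "inverse x"] exists_least_iff[of "\<lambda>n. h ^ n * inverse x \<in> V"] by blast
  have "n = 0"
  proof (cases n)
    case (Suc m)
    have "\<rho> (h ^ n * inverse x) * \<rho> x = \<rho> (h ^ n)"
      using \<rho>_mult[OF n(1) assms(1)] \<open>x \<noteq> 0\<close> by (simp add: mult.assoc)
    also have "\<dots> = 0" using \<rho>_power[OF h_V, of n] \<rho>_h Suc by simp
    finally have "\<rho> (h ^ n * inverse x) = 0" using assms by simp
    with n(1) have "h ^ n * inverse x \<in> lev 1" using lev_1 by blast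
    moreover have "h ^ n * inverse x = h ^ 1 * (h ^ m * inverse x)"
      by (simp add: Suc mult.assoc)
    ultimately have "h ^ m * inverse x \<in> V" using lev_cancel[of 1] by simp
    with n(2) Suc show ?thesis by auto
  qed
  with n show ?thesis by simp
qed

sublocale residue_center: subfield residue_center
proof
  show "1 \<in> residue_center"
    using one_V \<rho>_one by (force simp: residue_center_def central_def)
  fix x y assume "x \<in> residue_center" "y \<in> residue_center"
  then obtain a b where a: "a \<in> V" "central a" "x = \<rho> a" and b: "b \<in> V" "central b" "y = \<rho> b"
    by (auto simp: residue_center_def)
  have "central (a - b)" "central (a * b)"
    using a b unfolding central_def by (simp add: algebra_simps, metis mult.assoc)
  then show "x - y \<in> residue_center" "x * y \<in> residue_center"
    unfolding a(3) b(3) residue_center_def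
    using a b by (auto simp: \<rho>_diff[symmetric] \<rho>_mult[symmetric] diff_V mult_V)
next
  fix x assume "x \<in> residue_center"
  then obtain a where a: "a \<in> V" "central a" "x = \<rho> a"
    by (auto simp: residue_center_def)
  show "inverse x \<in> residue_center"
  proof (cases "x = 0")
    case False
    then have i: "inverse a \<in> V" "a \<noteq> 0" using unit_inverse a \<rho>_zero by auto
    then have "x * \<rho> (inverse a) = 1" using \<rho>_mult[OF a(1) i(1)] a(3) \<rho>_one by simp
    then have "inverse x = \<rho> (inverse a)" by (simp add: inverse_unique)
    moreover have "central (inverse a)" using a(2) unfolding central_def by (metis inverse_central)
    ultimately show ?thesis using i by (auto simp: residue_center_def)
  qed (use zero_V \<rho>_zero in \<open>force simp: residue_center_def central_def\<close>)
qed

text \<open>The loss n is uniform in m: it only has to clear the denominators of the coefficients u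
  and w, past which the central \<open>h\<close> can be moved.\<close>

lemma mult_op_bounded: "mult_op f \<Longrightarrow> \<exists>n. \<forall>m. \<forall>x\<in>lev m. h ^ n * f x \<in> lev m"
proof (induction rule: mult_op.induct)
  case (base u w)
  obtain i j where ij: "h ^ i * u \<in> V" "h ^ j * w \<in> V" using absorb by metis
  have "h ^ (i + j) * (u * x * w) \<in> lev m" if "x \<in> lev m" for x m
  proof -
    have "h ^ (i + j) * (u * x * w) = (h ^ i * u) * x * (h ^ j * w)"
      by (simp add: power_add mult.assoc h_power_left_commute[of x j w]
        h_power_left_commute[of u j "x * w"])
    then show ?thesis using ij that by (simp add: lev_mult_V)
  qed
  then show ?case by blast
next
  case (add f g)
  then obtain i j where ij: "\<And>m x. x \<in> lev m \<Longrightarrow> h ^ i * f x \<in> lev m"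
    "\<And>m x. x \<in> lev m \<Longrightarrow> h ^ j * g x \<in> lev m" by blast
  have "h ^ (i + j) * (f x + g x) \<in> lev m" if "x \<in> lev m" for x m
  proof -
    have "h ^ (i + j) * (f x + g x) = h ^ j * (h ^ i * f x) + h ^ i * (h ^ j * g x)"
      by (simp add: power_add mult.assoc distrib_left h_power_left_commute[of "h ^ j" i "f x"])
    then show ?thesis using ij that
      by (simp add: lev_add lev_mult_V power_V h_V)
  qed
  then show ?case by blast
qed

text \<open>Writing \<open>u * b * w = u * w * b + u * (b * w - w * b)\<close> shows that a multiplication
  operator \<open>f\<close> maps an element \<open>b\<close> that is close to the center into the vicinity
  of \<open>f 1 * b\<close>.\<close>

lemma mult_op_near_center:
  "mult_op f \<Longrightarrow> \<exists>n. \<forall>m b. (\<forall>x\<in>V. b * x - x * b \<in> lev m) \<longrightarrow> h ^ n * (f b - f 1 * b) \<in> lev m"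
proof (induction rule: mult_op.induct)
  case (base u w)
  obtain i j where ij: "h ^ i * u \<in> V" "h ^ j * w \<in> V" using absorb by metis
  have "h ^ (i + j) * (u * b * w - u * 1 * w * b) \<in> lev m"
    if b: "\<forall>x\<in>V. b * x - x * b \<in> lev m" for b m
  proof -
    have "h ^ (i + j) * (u * b * w - u * 1 * w * b)
        = (h ^ i * u) * (b * (h ^ j * w) - (h ^ j * w) * b)"
      by (simp add: power_add mult.assoc right_diff_distrib h_power_left_commute[of b j w]
        h_power_left_commute[of u j "b * w"] h_power_left_commute[of u j "w * b"])
    then show ?thesis using ij b by (simp add: lev_mult_V)
  qed
  then show ?case by blast
next
  case (add f g)
  then obtain i j where
    ij: "\<And>m b. (\<forall>x\<in>V. b * x - x * b \<in> lev m) \<Longrightarrow> h ^ i * (f b - f 1 * b) \<in> lev m"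
    "\<And>m b. (\<forall>x\<in>V. b * x - x * b \<in> lev m) \<Longrightarrow> h ^ j * (g b - g 1 * b) \<in> lev m" by blast
  have "h ^ (i + j) * (f b + g b - (f 1 + g 1) * b) \<in> lev m"
    if b: "\<forall>x\<in>V. b * x - x * b \<in> lev m" for b m
  proof -
    have "h ^ (i + j) * (f b + g b - (f 1 + g 1) * b)
      = h ^ j * (h ^ i * (f b - f 1 * b)) + h ^ i * (h ^ j * (g b - g 1 * b))"
    proof -
      have "f b + g b - (f 1 + g 1) * b = (f b - f 1 * b) + (g b - g 1 * b)"
        by (simp add: algebra_simps)
      then show ?thesis
        by (simp only: power_add mult.assoc distrib_left h_power_left_commute[of "h ^ j" i "f b - f 1 * b"])
    qed
    then show ?thesis using ij[OF b]
      by (simp add: lev_add lev_mult_V power_V h_V)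
  qed
  then show ?case by blast
qed

end

lemma pderiv_sum: "pderiv (\<Sum>i\<in>I. f i) = (\<Sum>i\<in>I. pderiv (f i))"
  by (induction I rule: infinite_finite_induct) (simp_all add: pderiv_add)

section \<open>Commutators of powers and lifting of residue bases\<close>

context central_place
begin

text \<open>The commutator with \<open>x\<close> is a derivation, and this is its power rule for
  leading coefficients at level m. It holds only after applying \<open>\<rho>\<close>, where b and y
  commute. The truncated exponent q - 1 is harmless, since for q = 0 the factor
  \<open>of_nat q\<close> vanishes.\<close>

lemma commutator_power:
  assumes b: "b \<in> V" and y: "y \<in> V" "b * x - x * b = h ^ m * y"
  shows "\<exists>w\<in>V. b ^ q * x - x * b ^ q = h ^ m * w \<and> \<rho> w = of_nat q * \<rho> b ^ (q - 1) * \<rho> y"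
proof (induction q)
  case 0
  show ?case using zero_V \<rho>_zero by (intro bexI[of _ 0]) auto
next
  case (Suc q)
  then obtain w where w: "w \<in> V" "b ^ q * x - x * b ^ q = h ^ m * w"
    "\<rho> w = of_nat q * \<rho> b ^ (q - 1) * \<rho> y" by blast
  have "b ^ Suc q * x - x * b ^ Suc q = b * (b ^ q * x - x * b ^ q) + (b * x - x * b) * b ^ q"
    by (simp add: algebra_simps)
  also have "\<dots> = h ^ m * (b * w + y * b ^ q)"
    unfolding w(2) y(2) by (simp add: distrib_left mult.assoc h_power_left_commute[of b m w])
  finally have "b ^ Suc q * x - x * b ^ Suc q = h ^ m * (b * w + y * b ^ q)" .
  moreover have "\<rho> (b * w + y * b ^ q) = of_nat (Suc q) * \<rho> b ^ (Suc q - 1) * \<rho> y"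
    using b y(1) w by (cases q) (simp_all add: \<rho>_add \<rho>_mult \<rho>_power power_V mult_V \<rho>_one one_V algebra_simps)
  moreover have "b * w + y * b ^ q \<in> V"
    using b y w by (intro add_V mult_V power_V)
  ultimately show ?case by blast
qed

text \<open>Each p-th power gains a level because the power rule gives the leading coefficient of
  the new commutator the factor p, which is 0 in the residue field.\<close>

lemma commutator_char_power:
  assumes "CHAR('k) = p" "b \<in> V"
  shows "\<forall>x\<in>V. b ^ (p ^ e) * x - x * b ^ (p ^ e) \<in> lev e"
proof (induction e)
  case 0
  then show ?case using assms by (simp add: lev_0 diff_V mult_V)
next
  case (Suc e)
  show ?case
  proof
    fix x assume "x \<in> V"
    with Suc obtain y where y: "y \<in> V" "b ^ (p ^ e) * x - x * b ^ (p ^ e) = h ^ e * y"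
      by (auto simp: lev_def)
    have "b ^ (p ^ e) \<in> V" using assms by (simp add: power_V)
    from commutator_power[OF this y, of p] obtain w where
      w: "w \<in> V" "(b ^ (p ^ e)) ^ p * x - x * (b ^ (p ^ e)) ^ p = h ^ e * w" "\<rho> w = 0"
      using assms(1) by auto
    then show "b ^ (p ^ Suc e) * x - x * b ^ (p ^ Suc e) \<in> lev (Suc e)"
      by (simp add: power_mult[symmetric] mult.commute lev_Suc)
  qed
qed

text \<open>A relation over the center is first made primitive by a central factor; its residue is
  then a nontrivial relation among the elements of \<open>S\<close>.\<close>

lemma independent_lift:
  assumes S: "finite S" "lin_free residue_center S"
    and \<tau>: "\<And>s. s \<in> S \<Longrightarrow> \<tau> s \<in> V \<and> \<rho> (\<tau> s) = s"
  shows "center.independent (\<tau> ` S)"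
proof
  have inj: "inj_on \<tau> S" using \<tau> by (metis inj_onI)
  assume "center.dependent (\<tau> ` S)"
  then obtain u s where u: "s \<in> S" "u (\<tau> s) \<noteq> 0" "(\<Sum>v\<in>\<tau> ` S. center_scale (u v) v) = 0"
    using S(1) by (auto simp: center.dependent_finite)
  define c where "c s = of_center (u (\<tau> s))" for s
  have "c s \<noteq> 0" using u(2) by (metis c_def of_center_inject zero_center.rep_eq)
  then obtain z where z: "central z" "\<forall>s\<in>S. z * c s \<in> V" "\<exists>s\<in>S. \<rho> (z * c s) \<noteq> 0"
    using scale_to_unit[OF S(1) u(1), of c] by blast
  have "(\<Sum>s\<in>S. (z * c s) * \<tau> s) = z * (\<Sum>s\<in>S. c s * \<tau> s)"
    by (simp add: sum_distrib_left mult.assoc)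
  also have "\<dots> = 0" using u(3) by (simp add: sum.reindex[OF inj] c_def center_scale_def)
  finally have "\<rho> (\<Sum>s\<in>S. (z * c s) * \<tau> s) = 0" using \<rho>_zero by simp
  then have "(\<Sum>s\<in>S. \<rho> (z * c s) * s) = 0"
    using z(2) \<tau> by (simp add: \<rho>_sum mult_V \<rho>_mult cong: sum.cong)
  moreover have "central (z * c s)" for s
    using z(1) central_of_center[of "u (\<tau> s)"] unfolding c_def central_def by (metis mult.assoc)
  then have "\<forall>s\<in>S. \<rho> (z * c s) \<in> residue_center"
    using z(2) by (auto simp: residue_center_def)
  ultimately have "\<forall>s\<in>S. \<rho> (z * c s) = 0"
    using S(2)[unfolded lin_free_def, THEN spec[of _ "\<lambda>s. \<rho> (z * c s)"], THEN mp] by blast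
  then show False using z(3) by blast
qed

lemma center_span_scale: "central z \<Longrightarrow> x \<in> center.span S \<Longrightarrow> z * x \<in> center.span S"
  using center.span_scale[of x S "to_center z"] by (simp add: center_scale_def of_center_to_center)

text \<open>Successive approximation: the residue of the current error divided by
  \<open>h ^ n\<close> is expanded in \<open>S\<close>, the coefficients are lifted to central
  elements of \<open>V\<close>, and the correction times \<open>h ^ n\<close> still lies in the span
  because \<open>h\<close> is central.\<close>

lemma approximate_by_span:
  assumes S: "finite S" "lin_span residue_center S = UNIV"
    and \<tau>: "\<And>s. s \<in> S \<Longrightarrow> \<tau> s \<in> V \<and> \<rho> (\<tau> s) = s"
    and y: "y \<in> V"
  shows "\<exists>v\<in>center.span (\<tau> ` S). y - v \<in> lev n"
proof (induction n)
  case 0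
  then show ?case using y center.span_zero by (intro bexI[of _ 0]) (auto simp: lev_0)
next
  case (Suc n)
  then obtain v y' where v: "v \<in> center.span (\<tau> ` S)" "y' \<in> V" "y - v = h ^ n * y'"
    by (auto simp: lev_def)
  have "\<rho> y' \<in> lin_span residue_center S" using S by simp
  then obtain c where c: "\<forall>s\<in>S. c s \<in> residue_center" "\<rho> y' = (\<Sum>s\<in>S. c s * s)"
    by (auto simp: lin_span_def)
  then obtain z where z: "\<And>s. s \<in> S \<Longrightarrow> z s \<in> V \<and> central (z s) \<and> c s = \<rho> (z s)"
    unfolding residue_center_def by simp metis
  define v' where "v' = (\<Sum>s\<in>S. z s * \<tau> s)"
  have v'_span: "v' \<in> center.span (\<tau> ` S)"
    unfolding v'_def using z by (intro center.span_sum center_span_scale center.span_base) auto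
  have v'_V: "v' \<in> V" unfolding v'_def using z \<tau> by (intro sum_V mult_V) auto
  have "\<rho> v' = \<rho> y'"
    unfolding v'_def c(2) using z \<tau> by (simp add: \<rho>_sum mult_V \<rho>_mult cong: sum.cong)
  then have "h ^ n * (y' - v') \<in> lev (Suc n)"
    using v(2) v'_V by (simp add: lev_Suc diff_V \<rho>_diff)
  moreover have "y - (v + h ^ n * v') = h ^ n * (y' - v')"
    using v(3) by (simp add: algebra_simps)
  moreover have "v + h ^ n * v' \<in> center.span (\<tau> ` S)"
    by (intro center.span_add v(1) center_span_scale central_h_power v'_span)
  ultimately show ?case by metis
qed

text \<open>Proper subspaces of finite dimension are closed, because the multiplication operators
  that separate points from them are bounded. No completeness is needed.\<close>

lemma span_lift:
  assumes S: "finite S" "lin_free residue_center S" "lin_span residue_center S = UNIV"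
    and \<tau>: "\<And>s. s \<in> S \<Longrightarrow> \<tau> s \<in> V \<and> \<rho> (\<tau> s) = s"
  shows "center.span (\<tau> ` S) = UNIV"
proof (rule ccontr)
  assume "center.span (\<tau> ` S) \<noteq> UNIV"
  then obtain e where e: "e \<notin> center.span (\<tau> ` S)" by blast
  have fin: "finite (\<tau> ` S)" using S by simp
  obtain f where "\<forall>s\<in>\<tau> ` S. mult_op (f s)"
    "\<forall>s\<in>\<tau> ` S. \<forall>t\<in>\<tau> ` S. f s t = (if s = t then 1 else 0)"
    using mult_op_dual[OF fin independent_lift[OF S(1,2) \<tau>]] by blast
  then obtain g where g: "mult_op g" "\<forall>s\<in>\<tau> ` S. g s = 0" "g e = 1"
    using mult_op_separates[OF fin _ _ e, of f] by metis
  have g0: "g v = 0" if "v \<in> center.span (\<tau> ` S)" for v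
  proof -
    obtain u where "v = (\<Sum>s\<in>\<tau> ` S. center_scale (u s) s)"
      using \<open>v \<in> _\<close> unfolding center.span_finite[OF fin] by blast
    then show ?thesis
      using g by (simp only: mult_op_sum_arg center_scale_def mult_op_central central_of_center)
        (intro sum.neutral, simp)
  qed
  obtain m where m: "h ^ m * e \<in> V" using absorb by blast
  obtain n where n: "\<And>j x. x \<in> lev j \<Longrightarrow> h ^ n * g x \<in> lev j"
    using mult_op_bounded[OF g(1)] by blast
  \<comment> \<open>The operator \<open>g\<close> sends the error to g(h^m e) = h^m and loses at
    most n levels. An error one level beyond n + m would thus force h^(n+m) into a level that it
    does not reach.\<close>
  obtain v where v: "v \<in> center.span (\<tau> ` S)" "h ^ m * e - v \<in> lev (Suc (n + m))"
    using approximate_by_span[OF S(1,3) \<tau> m] by metis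
  have "g (h ^ m * e - v) = g (h ^ m * e) - g v"
    using mult_op_plus[OF g(1), of "h ^ m * e - v" v] by simp
  also have "\<dots> = h ^ m"
    using g0[OF v(1)] g by (simp add: mult_op_central central_h_power)
  finally have "h ^ (n + m) \<in> lev (Suc (n + m))"
    using n[OF v(2)] by (simp add: power_add)
  then show False using h_power_notin_lev by blast
qed

end

section \<open>Finite dimension over the center\<close>

locale finite_central_place = central_place V h \<rho> +
  fin: finite_dimensional_vector_space "center_scale :: 'd center \<Rightarrow> 'd \<Rightarrow> 'd" B
  for V :: "'d::division_ring set" and h and \<rho> :: "'d \<Rightarrow> 'k::field" and B :: "'d set"
begin

text \<open>In a basis \<open>E\<close> containing 1, the coordinates of \<open>b\<close> are its
  images under the dual operators. Those belonging to e \<noteq> 1 vanish at 1, so on an element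
  with small commutators they are small. Hence \<open>b\<close> is congruent modulo \<open>h\<close>
  to its central coordinate at 1. The bound n depends only on \<open>E\<close> and its dual system,
  not on \<open>b\<close>.\<close>

lemma residue_in_residue_center:
  "\<exists>n. \<forall>b\<in>V. (\<forall>x\<in>V. b * x - x * b \<in> lev n) \<longrightarrow> \<rho> b \<in> residue_center"
proof -
  define E where "E = center.extend_basis {1 :: 'd}"
  have ind1: "center.independent {1 :: 'd}" by simp
  have E: "center.independent E" "center.span E = UNIV" "1 \<in> E"
    unfolding E_def using center.independent_extend_basis[OF ind1]
      center.span_extend_basis[OF ind1] center.extend_basis_superset[OF ind1] by auto
  have fin: "finite E" using fin.finiteI_independent[OF E(1)] .
  obtain f where f: "\<forall>s\<in>E. mult_op (f s)" "\<forall>s\<in>E. \<forall>t\<in>E. f s t = (if s = t then 1 else 0)"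
    using mult_op_dual[OF fin E(1)] by blast
  have "\<forall>e\<in>E. \<exists>n. \<forall>m b. (\<forall>x\<in>V. b * x - x * b \<in> lev m) \<longrightarrow> h ^ n * (f e b - f e 1 * b) \<in> lev m"
    using f(1) mult_op_near_center by blast
  then obtain i where i: "\<And>e m b. e \<in> E \<Longrightarrow> \<forall>x\<in>V. b * x - x * b \<in> lev m \<Longrightarrow>
      h ^ i e * (f e b - f e 1 * b) \<in> lev m"
    by metis
  have "\<forall>e. \<exists>j. h ^ j * e \<in> V" using absorb by blast
  then obtain j where j: "\<And>e. h ^ j e * e \<in> V" by metis
  \<comment> \<open>For each e, \<open>i e\<close> levels are lost by the dual operator and
    \<open>j e\<close> by the denominator of e. The sum dominates every single loss, and the
    successor leaves at least level 1.\<close>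
  define n where "n = Suc (\<Sum>e\<in>E. i e + j e)"
  have "\<rho> b \<in> residue_center" if b: "b \<in> V" "\<forall>x\<in>V. b * x - x * b \<in> lev n" for b
  proof -
    obtain u where u: "b = (\<Sum>e\<in>E. of_center (u e) * e)"
      using E(2) unfolding center.span_finite[OF fin] center_scale_def by blast
    have fe: "f t b = of_center (u t)" if "t \<in> E" for t
    proof -
      have "f t b = (\<Sum>e\<in>E. if e = t then of_center (u t) else 0)"
        unfolding u using that f
        by (simp add: mult_op_sum_arg mult_op_central cong: sum.cong) (rule sum.cong, auto)
      then show ?thesis using fin that by simp
    qed
    have "of_center (u e) * e \<in> lev 1" if e: "e \<in> E - {1}" for e
    proof -
      have "f e 1 = 0" using f(2) e E(3) by auto
      then have "h ^ i e * of_center (u e) \<in> lev n"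
        using i[of e b n] b(2) e fe by auto
      then have "(h ^ i e * of_center (u e)) * (h ^ j e * e) \<in> lev n"
        using j by (rule lev_mult_V)
      then have "h ^ (i e + j e) * (of_center (u e) * e) \<in> lev n"
        by (simp add: power_add mult.assoc h_power_left_commute[of "of_center (u e)" "j e" e])
      moreover have le: "i e + j e \<le> (\<Sum>e\<in>E. i e + j e)"
        using fin e by (intro member_le_sum) auto
      ultimately have "of_center (u e) * e \<in> lev (n - (i e + j e))"
        using lev_shift[of "i e + j e" "of_center (u e) * e" "n - (i e + j e)"] by (simp add: n_def)
      moreover have "1 \<le> n - (i e + j e)" using le by (simp add: n_def)
      ultimately show ?thesis using lev_antimono by blast
    qed
    then have "(\<Sum>e\<in>E - {1}. of_center (u e) * e) \<in> lev 1" by (intro lev_sum)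
    moreover have "b = of_center (u 1) + (\<Sum>e\<in>E - {1}. of_center (u e) * e)"
      unfolding u using fin E(3) by (subst sum.remove[of E 1]) auto
    ultimately have *: "b - of_center (u 1) \<in> lev 1" by simp
    then have "b - of_center (u 1) \<in> V" "\<rho> (b - of_center (u 1)) = 0" using lev_1 by blast+
    moreover from this have "of_center (u 1) \<in> V" using diff_V[OF b(1)] by fastforce
    ultimately have "\<rho> b = \<rho> (of_center (u 1))" using \<rho>_diff b(1) by simp
    then show ?thesis using \<open>of_center (u 1) \<in> V\<close> by (auto simp: residue_center_def)
  qed
  then show ?thesis by blast
qed

theorem card_basis_residue_char:
  assumes p: "CHAR('k) = p" "p > 0"
  shows "\<exists>e. card B = p ^ e"
proof -
  have "prime p" using p prime_CHAR_semidom[where ?'a = 'k] by simp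
  have "\<forall>s. \<exists>x. x \<in> V \<and> \<rho> x = s" using \<rho>_surj by blast
  then obtain \<tau> where \<tau>: "\<And>s. \<tau> s \<in> V \<and> \<rho> (\<tau> s) = s" by metis
  have inj: "inj_on \<tau> S" for S by (rule inj_on_inverseI[of _ \<rho>]) (use \<tau> in blast)
  obtain n where n: "\<And>b. b \<in> V \<Longrightarrow> (\<forall>x\<in>V. b * x - x * b \<in> lev n) \<Longrightarrow> \<rho> b \<in> residue_center"
    using residue_in_residue_center by blast
  \<comment> \<open>The exponent n works for all c at once: n successive p-th powers bring the
    commutators of any lift down to level n.\<close>
  have insep: "\<exists>e. c ^ (p ^ e) \<in> residue_center" for c
  proof
    show "c ^ (p ^ n) \<in> residue_center"
    proof -
      have V: "\<tau> c \<in> V" and c: "\<rho> (\<tau> c) = c" using \<tau> by blast+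
      have "\<rho> (\<tau> c ^ (p ^ n)) \<in> residue_center"
        using n[OF power_V[OF V] commutator_char_power[OF p(1) V]] .
      then show ?thesis by (simp only: \<rho>_power[OF V] c)
    qed
  qed
  \<comment> \<open>Lifting independent sets shows that the residue extension is finite, which is
    what stops the tower of p-th roots.\<close>
  have bound: "card S \<le> card B" if "finite S" "lin_free residue_center S" for S
    using fin.independent_card_le_dim[OF subset_UNIV independent_lift[OF that \<tau>]]
    by (simp add: card_image[OF inj])
  obtain S e where S: "finite S" "card S = p ^ e" "lin_free residue_center S"
    "lin_span residue_center S = UNIV"
    using residue_center.purely_inseparable_basis[OF \<open>prime p\<close> p(1) insep bound] by blast
  have "card (\<tau> ` S) = card B"
    using fin.dim_eq_card[OF _ independent_lift[OF S(1,3) \<tau>], of UNIV] span_lift[OF S(1,3,4) \<tau>]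
    by (simp only: fin.span_UNIV fin.dim_UNIV)
  then have "card B = p ^ e" using S(2) by (simp add: card_image[OF inj])
  then show ?thesis ..
qed

text \<open>The powers of \<open>a\<close> up to the dimension satisfy a relation over the center;
  made primitive and reduced by \<open>\<rho>\<close>, it remains a nonzero polynomial.\<close>

lemma residue_algebraic:
  assumes a: "a \<in> V"
  shows "\<exists>q. q \<noteq> 0 \<and> (\<forall>i. coeff q i \<in> residue_center) \<and> poly q (\<rho> a) = 0"
proof -
  define n where "n = card B"
  have "\<exists>c. (\<forall>i. central (c i)) \<and> (\<exists>i\<le>n. c i \<noteq> 0) \<and> (\<Sum>i\<le>n. c i * a ^ i) = 0"
  \<comment> \<open>Linear dependence concerns sets, so the case of two coinciding powers needs a
    relation of its own, the difference of the two.\<close>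
  proof (cases "inj_on (\<lambda>i. a ^ i) {..n}")
    case True
    let ?S = "(\<lambda>i. a ^ i) ` {..n}"
    have "card ?S = Suc n" by (simp add: card_image[OF True])
    then have "center.dependent ?S"
      using fin.independent_card_le_dim[OF subset_UNIV, of ?S] by (auto simp: n_def)
    then obtain u where u: "\<exists>v\<in>?S. u v \<noteq> 0" "(\<Sum>v\<in>?S. center_scale (u v) v) = 0"
      by (auto simp: center.dependent_finite)
    have "\<exists>i\<le>n. of_center (u (a ^ i)) \<noteq> 0"
      using u(1) by (auto) (metis of_center_inject zero_center.rep_eq)
    then show ?thesis
      using u(2) by (intro exI[of _ "\<lambda>i. of_center (u (a ^ i))"])
        (simp add: sum.reindex[OF True] center_scale_def)
  next
    case False
    then obtain i j where ij: "i \<le> n" "j \<le> n" "i \<noteq> j" "a ^ i = a ^ j" by (auto simp: inj_on_def)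
    define c where "c l = (if l = i then 1 else 0) - (if l = j then 1 else (0::'d))" for l
    have "(\<Sum>l\<le>n. c l * a ^ l) =
      (\<Sum>l\<le>n. if l = i then a ^ i else 0) - (\<Sum>l\<le>n. if l = j then a ^ j else 0)"
      unfolding sum_subtractf[symmetric] by (rule sum.cong) (auto simp: c_def)
    also have "\<dots> = 0" using ij by simp
    finally show ?thesis
      using ij by (intro exI[of _ c]) (auto simp: c_def central_def intro!: exI[of _ i])
  qed
  then obtain c l where c: "\<And>i. central (c i)" "l \<le> n" "c l \<noteq> 0" "(\<Sum>i\<le>n. c i * a ^ i) = 0" by blast
  obtain z where z: "central z" "\<forall>i\<in>{..n}. z * c i \<in> V" "\<exists>i\<in>{..n}. \<rho> (z * c i) \<noteq> 0"
    using scale_to_unit[of "{..n}" l c] c by auto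
  have cen: "central (z * c i)" for i using z(1) c(1) unfolding central_def by (metis mult.assoc)
  define q where "q = (\<Sum>i\<le>n. monom (\<rho> (z * c i)) i)"
  have cq: "coeff q i = (if i \<le> n then \<rho> (z * c i) else 0)" for i
    by (auto simp: q_def coeff_sum)
  have "(\<Sum>i\<le>n. (z * c i) * a ^ i) = z * (\<Sum>i\<le>n. c i * a ^ i)"
    by (simp add: sum_distrib_left mult.assoc)
  then have "\<rho> (\<Sum>i\<le>n. (z * c i) * a ^ i) = 0" using c(4) \<rho>_zero by simp
  moreover have "\<rho> (\<Sum>i\<le>n. (z * c i) * a ^ i) = (\<Sum>i\<le>n. \<rho> (z * c i) * \<rho> a ^ i)"
  proof -
    have zV: "z * c i \<in> V" if "i \<le> n" for i using z(2) that by simp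
    have "\<rho> ((z * c i) * a ^ i) = \<rho> (z * c i) * \<rho> a ^ i" if "i \<le> n" for i
      using \<rho>_mult[OF zV[OF that] power_V[OF a]] \<rho>_power[OF a] by simp
    then show ?thesis
      by (subst \<rho>_sum) (use mult_V[OF zV power_V[OF a]] in simp_all)
  qed
  ultimately have "poly q (\<rho> a) = 0"
    by (simp add: q_def poly_sum poly_monom)
  moreover have "q \<noteq> 0" using z(3) cq by (metis atMost_iff coeff_0)
  moreover have "coeff q i \<in> residue_center" for i
    using cq z(2) cen residue_center.zero_closed by (auto simp: residue_center_def)
  ultimately show ?thesis by blast
qed

text \<open>The Poisson bracket is evaluated at a single pair only. Let \<open>q\<close> be a
  minimal polynomial of the residue of \<open>a\<close> over the residues of the center, and let
  \<open>s\<close> be the value at \<open>a\<close> of a lift of \<open>q\<close> with central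
  coefficients. The leading coefficient of [s, b] at level n has residue q'(\<rho> a) times that of
  [a, b]. It vanishes because \<open>s\<close> is divisible by \<open>h\<close>, so q'(\<rho> a) =
  0, against minimality in characteristic 0.\<close>

theorem commutative_residue_char_0:
  fixes x y :: 'd
  assumes char: "CHAR('k) = 0"
  shows "x * y = y * x"
proof (rule ccontr)
  assume "x * y \<noteq> y * x"
  obtain m where m: "h ^ m * x \<in> V" using absorb by blast
  obtain m' where m': "h ^ m' * y \<in> V" using absorb by blast
  \<comment> \<open>The largest n with \<open>P n\<close> is the order of the bracket. It exists
    because the noncommuting pair, scaled into \<open>V\<close>, has a nonzero commutator, which
    leaves some level.\<close>
  define P where "P n \<longleftrightarrow> (\<forall>a\<in>V. \<forall>b\<in>V. a * b - b * a \<in> lev n)" for n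
  have "(h ^ m * x) * (h ^ m' * y) - (h ^ m' * y) * (h ^ m * x) = h ^ m * (h ^ m' * (x * y - y * x))"
    by (simp add: right_diff_distrib mult.assoc h_power_left_commute[of x m' y]
      h_power_left_commute[of y m x] h_power_left_commute[of "h ^ m'" m "y * x"])
  also have "\<dots> \<noteq> 0" using \<open>x * y \<noteq> y * x\<close> h_nz by simp
  finally obtain N where "(h ^ m * x) * (h ^ m' * y) - (h ^ m' * y) * (h ^ m * x) \<notin> lev N"
    using lev_separated by blast
  then have "\<not> P N" using m m' unfolding P_def by blast
  moreover have "P 0" by (simp add: P_def lev_0 diff_V mult_V)
  ultimately obtain n where n: "P n" "\<not> P (Suc n)" using nat_induct[of P N] by blast
  then obtain a b where ab: "a \<in> V" "b \<in> V" "a * b - b * a \<notin> lev (Suc n)" "a * b - b * a \<in> lev n"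
    unfolding P_def by blast
  then obtain y where y: "y \<in> V" "a * b - b * a = h ^ n * y" by (auto simp: lev_def)
  then have "\<rho> y \<noteq> 0" using ab(3) lev_Suc by simp
  define Q where "Q q \<longleftrightarrow> q \<noteq> 0 \<and> (\<forall>i. coeff q i \<in> residue_center) \<and> poly q (\<rho> a) = 0" for q
  obtain q where q: "Q q" "\<And>r. Q r \<Longrightarrow> degree q \<le> degree r"
    using residue_algebraic[OF ab(1)] unfolding Q_def[symmetric] by (metis ex_has_least_nat)
  have "\<forall>i. \<exists>z. z \<in> V \<and> central z \<and> coeff q i = \<rho> z"
    using q(1) by (auto simp: Q_def residue_center_def)
  then obtain z where z: "\<And>i. z i \<in> V \<and> central (z i) \<and> coeff q i = \<rho> (z i)" by metis
  have "\<forall>i. \<exists>w. w \<in> V \<and> a ^ i * b - b * a ^ i = h ^ n * w \<and> \<rho> w = of_nat i * \<rho> a ^ (i - 1) * \<rho> y"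
    using commutator_power[OF ab(1) y] by blast
  then obtain w where w: "\<And>i. w i \<in> V \<and> a ^ i * b - b * a ^ i = h ^ n * w i \<and>
      \<rho> (w i) = of_nat i * \<rho> a ^ (i - 1) * \<rho> y"
    by metis
  let ?d = "degree q"
  define s where "s = (\<Sum>i\<le>?d. z i * a ^ i)"
  have "s \<in> V" unfolding s_def using z ab by (intro sum_V mult_V power_V) auto
  moreover have "\<rho> s = 0"
  proof -
    have "\<rho> s = (\<Sum>i\<le>?d. \<rho> (z i) * \<rho> a ^ i)"
      unfolding s_def using z ab(1) by (simp add: \<rho>_sum \<rho>_mult \<rho>_power mult_V power_V)
    also have "\<dots> = poly q (\<rho> a)" unfolding poly_altdef using z by simp
    finally show ?thesis using q(1) by (simp add: Q_def)
  qed
  ultimately obtain s' where s': "s' \<in> V" "s = h * s'" using \<rho>_ker by blast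
  \<comment> \<open>The commutator of s' with b already lies in level n, so the factor
    \<open>h\<close> gains one level.\<close>
  have "s * b - b * s = h ^ 1 * (s' * b - b * s')"
    using h_power_left_commute[of b 1 s'] by (simp add: s'(2) right_diff_distrib mult.assoc)
  moreover have "s' * b - b * s' \<in> lev n" using n(1) s' ab unfolding P_def by blast
  ultimately have "s * b - b * s \<in> lev (Suc n)" using lev_shift[of 1 _ n] by simp
  moreover have "s * b - b * s = h ^ n * (\<Sum>i\<le>?d. z i * w i)"
  proof -
    have "s * b - b * s = (\<Sum>i\<le>?d. z i * (a ^ i * b - b * a ^ i))"
      unfolding s_def sum_distrib_left sum_distrib_right sum_subtractf[symmetric]
    proof (intro sum.cong refl)
      fix i
      have "b * (z i * a ^ i) = z i * (b * a ^ i)"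
        using z[of i] unfolding central_def by (metis mult.assoc)
      then show "z i * a ^ i * b - b * (z i * a ^ i) = z i * (a ^ i * b - b * a ^ i)"
        by (simp add: right_diff_distrib mult.assoc)
    qed
    also have "\<dots> = (\<Sum>i\<le>?d. h ^ n * (z i * w i))"
      by (intro sum.cong refl) (simp only: w h_power_left_commute[of "z _" n "w _"])
    finally show ?thesis by (simp add: sum_distrib_left)
  qed
  ultimately have "\<rho> (\<Sum>i\<le>?d. z i * w i) = 0"
    using lev_Suc[of "\<Sum>i\<le>?d. z i * w i" n] z w by (simp add: sum_V mult_V)
  then have "(\<Sum>i\<le>?d. coeff q i * (of_nat i * \<rho> a ^ (i - 1))) * \<rho> y = 0"
    using z w by (simp add: \<rho>_sum \<rho>_mult mult_V sum_distrib_right mult.assoc)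
  moreover have "poly (pderiv q) (\<rho> a) = (\<Sum>i\<le>?d. coeff q i * (of_nat i * \<rho> a ^ (i - 1)))"
  proof -
    have "pderiv q = pderiv (\<Sum>i\<le>?d. monom (coeff q i) i)" by (simp add: poly_as_sum_of_monoms)
    then show ?thesis
      by (simp add: pderiv_sum pderiv_monom poly_sum poly_monom mult_ac)
  qed
  ultimately have "poly (pderiv q) (\<rho> a) = 0" using \<open>\<rho> y \<noteq> 0\<close> by simp
  have "?d > 0"
  proof (rule ccontr)
    assume "\<not> ?d > 0"
    then obtain c where "q = [:c:]" by (auto elim: degree_eq_zeroE)
    then show False using q(1) by (auto simp: Q_def)
  qed
  then have "coeff (pderiv q) (?d - 1) = of_nat ?d * lead_coeff q"
    by (simp add: coeff_pderiv)
  moreover have "of_nat ?d \<noteq> (0::'k)"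
    using char \<open>?d > 0\<close> by (simp add: of_nat_eq_0_iff_char_dvd)
  ultimately have "pderiv q \<noteq> 0" using q(1) by (auto simp: Q_def)
  moreover have "coeff (pderiv q) i \<in> residue_center" for i
    using q(1) unfolding coeff_pderiv Q_def
    by (blast intro: residue_center.mult_closed residue_center.of_nat_closed)
  ultimately have "Q (pderiv q)" using \<open>poly (pderiv q) (\<rho> a) = 0\<close> by (simp add: Q_def)
  then have "?d \<le> degree (pderiv q)" by (rule q(2))
  also have "\<dots> \<le> ?d - 1"
    by (rule degree_le) (auto simp: coeff_pderiv coeff_eq_0)
  finally show False using \<open>?d > 0\<close> by simp
qed

end

section \<open>The place of a quantum formal deformation\<close>

locale deformation_fractions =
  quantum_formal_deformation s0 sA \<psi> + quotient_division_ring \<iota>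
  for s0 :: "'f::field \<Rightarrow> 'b::idom \<Rightarrow> 'b"
    and sA :: "'f fps \<Rightarrow> 'a::ring_1 \<Rightarrow> 'a"
    and \<psi> :: "'a set \<Rightarrow> 'b"
    and \<iota> :: "'a \<Rightarrow> 'd::division_ring"
begin

section \<open>The residue map of A and divisibility by the formal parameter\<close>

definition hb :: 'a where "hb = sA fps_X 1"

definition res :: "'a \<Rightarrow> 'b" where "res a = \<psi> (hbar_coset sA a)"

lemma scale_X: "sA fps_X x = hb * x"
  by (simp add: hb_def A.scale_mult_left)

lemma hb_commute: "x * hb = hb * x"
  by (simp add: hb_def A.scale_mult_left A.scale_mult_right)

lemma hb_power_commute: "x * hb ^ n = hb ^ n * x"
  using power_commuting_commutes[OF hb_commute[of x, symmetric]] by simp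

lemma scale_X_power: "sA (fps_X ^ n) x = hb ^ n * x"
proof (induction n)
  case (Suc n)
  have "sA (fps_X ^ Suc n) x = sA fps_X (sA (fps_X ^ n) x)" by simp
  then show ?case by (simp only: Suc scale_X power_Suc mult.assoc)
qed simp

lemma res_add: "res (a + b) = res a + res b" and res_mult: "res (a * b) = res a * res b"
  and res_one: "res 1 = 1"
  by (simp_all add: res_def \<psi>_add \<psi>_mult \<psi>_one)

lemma res_zero: "res 0 = 0"
  using res_add[of 0 1] by simp

lemma res_diff: "res (a - b) = res a - res b"
  using res_add[of "a - b" b] by simp

lemma res_surj: "\<exists>a. res a = c"
  using \<psi>_bij unfolding bij_betw_def res_def by (metis UNIV_I image_iff)

lemma res_eq_0_iff: "res a = 0 \<longleftrightarrow> (\<exists>x. a = hb * x)"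
proof
  assume "res a = 0"
  then have "\<psi> (hbar_coset sA a) = \<psi> (hbar_coset sA 0)" using res_zero by (simp add: res_def)
  then have "hbar_coset sA a = hbar_coset sA 0"
    using \<psi>_bij by (auto simp: bij_betw_def dest: inj_onD)
  moreover have "a \<in> hbar_coset sA a"
    unfolding hbar_coset_def scale_X by (intro CollectI exI[of _ 0]) simp
  ultimately show "\<exists>x. a = hb * x" by (auto simp: hbar_coset_def scale_X)
next
  \<comment> \<open>Since \<open>res\<close> is multiplicative, it suffices to treat
    \<open>hb\<close> itself.\<close>
  have "hbar_coset sA hb = hbar_coset sA 0"
    unfolding hbar_coset_def scale_X
  proof (intro equalityI subsetI)
    fix y assume "y \<in> {hb + hb * x | x. True}"
    then obtain x where "y = hb + hb * x" by blast
    then have "y = 0 + hb * (1 + x)" by (simp add: distrib_left)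
    then show "y \<in> {0 + hb * x | x. True}" by blast
  next
    fix y assume "y \<in> {0 + hb * x | x. True}"
    then obtain x where "y = 0 + hb * x" by blast
    then have "y = hb + hb * (x - 1)" by (simp add: right_diff_distrib)
    then show "y \<in> {hb + hb * x | x. True}" by blast
  qed
  then have "res hb = 0" using res_zero by (simp add: res_def)
  moreover assume "\<exists>x. a = hb * x"
  ultimately show "res a = 0" by (auto simp: res_mult)
qed

lemma hb_nz: "hb \<noteq> 0"
proof
  assume "hb = 0"
  obtain \<phi> where \<phi>: "module_hom sA (fps_scale s0) \<phi>" "bij \<phi>" using module_iso by blast
  interpret \<phi>: module_hom sA "fps_scale s0" \<phi> by (rule \<phi>(1))
  \<comment> \<open>The parameter sends this x to an element corresponding to the series X, whose
    coefficient of degree 1 is not 0.\<close>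
  obtain x where x: "\<phi> x = 1" using \<phi>(2) by (metis bij_pointE)
  have "fps_scale s0 fps_X (\<phi> x) = 0"
    using \<phi>.scale[of fps_X x] \<open>hb = 0\<close> by (simp add: scale_X \<phi>.zero)
  then have "fps_nth (fps_scale s0 fps_X (1 :: 'b fps)) 1 = 0" unfolding x by simp
  then show False by (simp add: fps_scale_def)
qed

text \<open>The isomorphism with the power series is only linear, but that suffices: powers of the
  parameter act through scalars, and a multiple of X^(i+1) has no coefficient of degree i.\<close>

lemma hb_separated:
  assumes "\<And>n. \<exists>y. a = hb ^ n * y"
  shows "a = 0"
proof -
  obtain \<phi> where \<phi>: "module_hom sA (fps_scale s0) \<phi>" "bij \<phi>" using module_iso by blast
  interpret \<phi>: module_hom sA "fps_scale s0" \<phi> by (rule \<phi>(1))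
  have "\<phi> a = 0"
  proof (rule fps_ext)
    fix i
    obtain y where "a = hb ^ Suc i * y" using assms by blast
    then have "a = sA (fps_X ^ Suc i) y" by (simp only: scale_X_power)
    then have "\<phi> a = fps_scale s0 (fps_X ^ Suc i) (\<phi> y)" by (simp only: \<phi>.scale)
    then show "fps_nth (\<phi> a) i = fps_nth 0 i"
      by (simp add: fps_scale_def fps_X_power_nth del: power_Suc)
  qed
  then have "\<phi> a = \<phi> 0" by (simp add: \<phi>.zero)
  then show ?thesis using \<phi>(2) by (meson bij_is_inj injD)
qed

lemma emb_zero: "\<iota> 0 = 0"
  using emb_add[of 0 0] by simp

lemma emb_diff: "\<iota> (a - b) = \<iota> a - \<iota> b"
  using emb_add[of "a - b" b] by (simp add: algebra_simps)

lemma emb_eq_iff: "\<iota> a = \<iota> b \<longleftrightarrow> a = b"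
  using emb_inj by (auto dest: injD)

lemma emb_eq_0_iff: "\<iota> a = 0 \<longleftrightarrow> a = 0"
  using emb_eq_iff[of a 0] by (simp add: emb_zero)

lemma emb_power: "\<iota> (a ^ n) = \<iota> a ^ n"
  by (induction n) (simp_all add: emb_one emb_mult)

lemma hb_power_cancel: "hb ^ n * a = hb ^ n * b \<longleftrightarrow> a = b"
proof
  assume "hb ^ n * a = hb ^ n * b"
  then have "\<iota> hb ^ n * \<iota> a = \<iota> hb ^ n * \<iota> b" by (metis emb_mult emb_power)
  then show "a = b" using hb_nz by (simp add: emb_eq_iff emb_eq_0_iff)
qed simp

lemma res_nz_imp_nz: "res b \<noteq> 0 \<Longrightarrow> \<iota> b \<noteq> 0"
  using res_zero emb_eq_0_iff by auto

text \<open>By separatedness there is a last power of \<open>hb\<close> dividing b. This is how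
  arbitrary denominators are reduced to denominators with nonzero residue.\<close>

lemma hb_factor:
  assumes "b \<noteq> 0"
  shows "\<exists>n b'. b = hb ^ n * b' \<and> res b' \<noteq> 0"
proof -
  define P where "P n \<longleftrightarrow> (\<exists>y. b = hb ^ n * y)" for n
  have "\<not> (\<forall>n. P n)" using hb_separated[of b] assms unfolding P_def by blast
  moreover have "P 0" by (simp add: P_def)
  ultimately obtain n where n: "P n" "\<not> P (Suc n)" using nat_induct[of P] by blast
  then obtain y where y: "b = hb ^ n * y" by (auto simp: P_def)
  have "res y \<noteq> 0"
  proof
    assume "res y = 0"
    then obtain z where "y = hb * z" using res_eq_0_iff by blast
    then have "b = hb ^ Suc n * z" unfolding y power_Suc2 by (simp only: mult.assoc)
    then show False using n(2) by (auto simp: P_def)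
  qed
  with y show ?thesis by blast
qed

text \<open>As A0 is a domain, a factor with nonzero residue contributes nothing to divisibility by
  \<open>hb\<close>; one power of \<open>hb\<close> is passed to \<open>u\<close> at a time.\<close>

lemma hb_dvd_left:
  assumes "res b \<noteq> 0" "b * u = hb ^ n * w"
  shows "\<exists>u'. u = hb ^ n * u'"
  using assms(2)
proof (induction n arbitrary: w)
  case (Suc n)
  have bu: "b * u = hb ^ n * (hb * w)" using Suc.prems by (simp add: power_Suc2 mult.assoc del: power_Suc)
  then obtain u' where u': "u = hb ^ n * u'" using Suc.IH by blast
  have "hb ^ n * (b * u') = b * u"
    unfolding u' by (metis hb_power_commute mult.assoc)
  then have "b * u' = hb * w" using bu hb_power_cancel by metis
  then have "res b * res u' = 0" using res_eq_0_iff res_mult by metis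
  then have "res u' = 0" using assms(1) by simp
  then obtain z where "u' = hb * z" using res_eq_0_iff by blast
  then have "u = hb ^ Suc n * z" using u' by (simp add: power_Suc2 mult.assoc del: power_Suc)
  then show ?case by blast
qed simp

lemma hb_dvd_right:
  assumes "res b \<noteq> 0" "u * b = hb ^ n * w"
  shows "\<exists>u'. u = hb ^ n * u'"
  using assms(2)
proof (induction n arbitrary: w)
  case (Suc n)
  have ub: "u * b = hb ^ n * (hb * w)" using Suc.prems by (simp add: power_Suc2 mult.assoc del: power_Suc)
  then obtain u' where u': "u = hb ^ n * u'" using Suc.IH by blast
  have "hb ^ n * (u' * b) = u * b"
    unfolding u' by (rule mult.assoc[symmetric])
  then have "u' * b = hb * w" using ub hb_power_cancel by metis
  then have "res u' * res b = 0" using res_eq_0_iff res_mult by metis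
  then have "res u' = 0" using assms(1) by simp
  then obtain z where "u' = hb * z" using res_eq_0_iff by blast
  then have "u = hb ^ Suc n * z" using u' by (simp add: power_Suc2 mult.assoc del: power_Suc)
  then show ?case by blast
qed simp

text \<open>Rewriting the left fraction b^(-1) a as a right fraction gives some common multiple b u
  = a v, where v may have residue 0. The power of \<open>hb\<close> in v then divides b u, hence u,
  and cancels from both sides.\<close>

lemma ore:
  assumes b: "res b \<noteq> 0"
  shows "\<exists>u v. res v \<noteq> 0 \<and> b * u = a * v"
proof -
  obtain u v where uv: "v \<noteq> 0" "inverse (\<iota> b) * \<iota> a = \<iota> u * inverse (\<iota> v)"
    using fraction by blast
  have "\<iota> b * \<iota> u = \<iota> b * (inverse (\<iota> b) * \<iota> a) * \<iota> v"
    using uv by (simp add: mult.assoc emb_eq_0_iff)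
  also have "\<dots> = \<iota> a * \<iota> v"
    using res_nz_imp_nz[OF b] by (simp add: mult.assoc[symmetric])
  finally have "b * u = a * v" by (metis emb_mult emb_eq_iff)
  obtain n v' where v': "v = hb ^ n * v'" "res v' \<noteq> 0" using hb_factor[OF uv(1)] by blast
  then have bu: "b * u = hb ^ n * (a * v')"
    using \<open>b * u = a * v\<close> by (metis hb_power_commute mult.assoc)
  then obtain u' where u': "u = hb ^ n * u'" using hb_dvd_left[OF b] by blast
  then have "hb ^ n * (b * u') = hb ^ n * (a * v')"
    using bu by (metis hb_power_commute mult.assoc)
  then have "b * u' = a * v'" using hb_power_cancel by blast
  with v'(2) show ?thesis by blast
qed

section \<open>Fractions whose denominator has nonzero residue\<close>

definition frac :: "'d \<Rightarrow> 'a \<Rightarrow> 'a \<Rightarrow> bool" where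
  "frac x a b \<longleftrightarrow> res b \<noteq> 0 \<and> x * \<iota> b = \<iota> a"

text \<open>The Ore localization of A at the complement of the ideal generated by \<open>hb\<close>,
  realized inside D.\<close>

definition val_ring :: "'d set" where
  "val_ring = {x. \<exists>a b. frac x a b}"

text \<open>A choice among all representing fractions, arbitrary outside \<open>val_ring\<close>;
  independence of the choice is proved in \<open>place_eq\<close>.\<close>

definition place :: "'d \<Rightarrow> 'b fract" where
  "place x = (SOME q. \<exists>a b. frac x a b \<and> q = Fract (res a) (res b))"

lemma frac_expand: "frac x a b \<Longrightarrow> res u \<noteq> 0 \<Longrightarrow> frac x (a * u) (b * u)"
  by (simp add: frac_def res_mult emb_mult mult.assoc[symmetric])

lemma common_denominator:
  assumes x: "frac x a b" and y: "frac y a' b'"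
  shows "\<exists>u v. res u \<noteq> 0 \<and> res v \<noteq> 0 \<and> b * u = b' * v \<and> frac x (a * u) (b * u) \<and> frac y (a' * v) (b * u)"
proof -
  obtain u v where uv: "res v \<noteq> 0" "b * u = b' * v" using ore[of b b'] x by (auto simp: frac_def)
  have "res b * res u = res b' * res v" using uv(2) by (metis res_mult)
  then have "res u \<noteq> 0" using uv(1) y by (auto simp: frac_def)
  moreover have "frac y (a' * v) (b * u)" unfolding uv(2) using frac_expand[OF y uv(1)] .
  ultimately show ?thesis using uv frac_expand[OF x] by blast
qed

text \<open>Over a common denominator two fractions for \<open>x\<close> have equal numerators in A,
  because \<open>\<iota>\<close> is injective. Their residues are then compared in the domain
  A0.\<close>

lemma place_eq:
  assumes "frac x a b"
  shows "place x = Fract (res a) (res b)"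
proof -
  have unique: "Fract (res a') (res b') = Fract (res a) (res b)" if x': "frac x a' b'" for a' b'
  proof -
    obtain u v where uv: "res u \<noteq> 0" "res v \<noteq> 0" "b * u = b' * v"
      "frac x (a * u) (b * u)" "frac x (a' * v) (b * u)"
      using common_denominator[OF assms x'] by blast
    have "a * u = a' * v" using uv(4,5) emb_eq_iff by (simp add: frac_def)
    then have 1: "res a * res u = res a' * res v" by (metis res_mult)
    have 2: "res b * res u = res b' * res v" using uv(3) by (metis res_mult)
    have "(res a' * res b) * (res u * res v) = (res a' * res v) * (res b * res u)" by (simp add: ac_simps)
    also have "\<dots> = (res a * res u) * (res b' * res v)" using 1 2 by simp
    also have "\<dots> = (res a * res b') * (res u * res v)" by (simp add: ac_simps)
    finally have "res a' * res b = res a * res b'" using uv(1,2) by simp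
    then show ?thesis using assms x' by (simp add: frac_def eq_fract)
  qed
  have "\<exists>q a b. frac x a b \<and> q = Fract (res a) (res b)" using assms by blast
  from someI_ex[OF this] show ?thesis unfolding place_def[symmetric] using unique by metis
qed

lemma frac_val_ring: "frac x a b \<Longrightarrow> x \<in> val_ring"
  by (auto simp: val_ring_def)

lemma frac_diff: "frac x a c \<Longrightarrow> frac y b c \<Longrightarrow> frac (x - y) (a - b) c"
  by (simp add: frac_def left_diff_distrib emb_diff)

text \<open>In a b^(-1) a' b'^(-1) the middle part b^(-1) a' is replaced by u v^(-1), using the Ore
  condition with residue control.\<close>

lemma frac_mult:
  assumes "frac x a b" "frac y a' b'"
  shows "\<exists>u v. res v \<noteq> 0 \<and> b * u = a' * v \<and> frac (x * y) (a * u) (b' * v)"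
proof -
  obtain u v where uv: "res v \<noteq> 0" "b * u = a' * v" using ore[of b a'] assms by (auto simp: frac_def)
  have "x * y * \<iota> (b' * v) = x * (y * \<iota> b') * \<iota> v" by (simp add: emb_mult mult.assoc)
  also have "\<dots> = x * \<iota> (a' * v)" using assms(2) by (simp add: frac_def emb_mult mult.assoc)
  also have "\<dots> = (x * \<iota> b) * \<iota> u" unfolding uv(2)[symmetric] by (simp add: emb_mult mult.assoc)
  also have "\<dots> = \<iota> (a * u)" using assms(1) by (simp add: frac_def emb_mult)
  finally show ?thesis using uv assms by (auto simp: frac_def res_mult)
qed

lemma central_emb_hb: "central (\<iota> hb)"
  unfolding central_def
proof
  fix x
  obtain a b where ab: "b \<noteq> 0" "x = \<iota> a * inverse (\<iota> b)" using fraction by blast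
  have c: "\<iota> hb * \<iota> y = \<iota> y * \<iota> hb" for y by (metis emb_mult hb_commute)
  have nz: "\<iota> b \<noteq> 0" using ab(1) by (simp add: emb_eq_0_iff)
  have "x * \<iota> hb = \<iota> a * (inverse (\<iota> b) * (\<iota> hb * \<iota> b) * inverse (\<iota> b))"
    unfolding ab(2) using nz by (simp add: mult.assoc)
  also have "\<dots> = \<iota> a * (\<iota> hb * inverse (\<iota> b))"
    unfolding c[of b] using nz by (simp add: mult.assoc[symmetric])
  also have "\<dots> = \<iota> hb * x" unfolding ab(2) by (metis c mult.assoc)
  finally show "\<iota> hb * x = x * \<iota> hb" ..
qed

lemma emb_hb_power_left_commute: "x * (\<iota> hb ^ n * y) = \<iota> hb ^ n * (x * y)"
proof -
  have "x * \<iota> hb ^ n = \<iota> hb ^ n * x"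
    using power_commuting_commutes[of "\<iota> hb" x n] central_emb_hb by (simp add: central_def)
  then show ?thesis by (simp only: mult.assoc[symmetric])
qed

sublocale central_place val_ring "\<iota> hb" place
proof
  have one: "frac 1 1 1" by (simp add: frac_def res_one emb_one)
  show "1 \<in> val_ring" using frac_val_ring[OF one] .
  show "place 1 = 1" using place_eq[OF one] by (simp add: res_one One_fract_def)
  show "central (\<iota> hb)" by (rule central_emb_hb)
  show "\<iota> hb \<noteq> 0" using hb_nz emb_eq_0_iff by simp
next
  fix x y assume "x \<in> val_ring" "y \<in> val_ring"
  then obtain a b a' b' where f: "frac x a b" "frac y a' b'" by (auto simp: val_ring_def)
  then obtain p q c where c: "frac x p c" "frac y q c" using common_denominator by blast
  show "x - y \<in> val_ring" using frac_val_ring[OF frac_diff[OF c]] .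
  have "res c \<noteq> 0" using c by (simp add: frac_def)
  then show "place (x - y) = place x - place y"
    by (simp add: place_eq[OF c(1)] place_eq[OF c(2)] place_eq[OF frac_diff[OF c]] res_diff
        eq_fract algebra_simps)
  obtain u v where uv: "res v \<noteq> 0" "b * u = a' * v" "frac (x * y) (a * u) (b' * v)"
    using frac_mult[OF f] by blast
  show "x * y \<in> val_ring" using frac_val_ring[OF uv(3)] .
  have "res b * res u = res a' * res v" using uv(2) by (metis res_mult)
  then have "res a * res u * (res b * res b') = res a * res a' * (res b' * res v)"
    by (metis mult.assoc mult.commute)
  then show "place (x * y) = place x * place y"
    using f uv(1) by (simp add: place_eq[OF f(1)] place_eq[OF f(2)] place_eq[OF uv(3)] res_mult
        eq_fract frac_def)
next
  fix c :: "'b fract"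
  obtain r s where rs: "c = Fract r s" "s \<noteq> 0" by (cases c) auto
  obtain a b where ab: "res a = r" "res b = s" using res_surj by metis
  have "frac (\<iota> a * inverse (\<iota> b)) a b"
    using ab rs(2) res_nz_imp_nz[of b] by (simp add: frac_def mult.assoc)
  then show "\<exists>x\<in>val_ring. place x = c" using place_eq frac_val_ring ab rs(1) by blast
next
  fix x
  show "x \<in> val_ring \<and> place x = 0 \<longleftrightarrow> (\<exists>y\<in>val_ring. x = \<iota> hb * y)"
  proof
    assume x: "x \<in> val_ring \<and> place x = 0"
    then obtain a b where ab: "frac x a b" by (auto simp: val_ring_def)
    then have "res a = 0" using x place_eq[OF ab] by (simp add: frac_def Zero_fract_def eq_fract)
    then obtain a' where a': "a = hb * a'" using res_eq_0_iff by blast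
    have nz: "\<iota> hb \<noteq> 0" using hb_nz emb_eq_0_iff by simp
    have "frac (inverse (\<iota> hb) * x) a' b"
      using ab nz by (simp add: frac_def a' emb_mult mult.assoc) (simp add: mult.assoc[symmetric])
    then have "inverse (\<iota> hb) * x \<in> val_ring" by (rule frac_val_ring)
    moreover have "x = \<iota> hb * (inverse (\<iota> hb) * x)" using nz by (simp add: mult.assoc[symmetric])
    ultimately show "\<exists>y\<in>val_ring. x = \<iota> hb * y" by blast
  next
    assume "\<exists>y\<in>val_ring. x = \<iota> hb * y"
    then obtain y a b where y: "frac y a b" "x = \<iota> hb * y" by (auto simp: val_ring_def)
    then have x: "frac x (hb * a) b" by (simp add: frac_def emb_mult mult.assoc)
    have "res (hb * a) = 0" using res_eq_0_iff by blast
    then have "place x = 0" using place_eq[OF x] x by (simp add: frac_def Zero_fract_def eq_fract)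
    then show "x \<in> val_ring \<and> place x = 0" using frac_val_ring[OF x] by simp
  qed
next
  fix x
  obtain a b where ab: "b \<noteq> 0" "x = \<iota> a * inverse (\<iota> b)" using fraction by blast
  \<comment> \<open>The power of \<open>hb\<close> in the denominator is exactly what has to be
    cleared.\<close>
  then obtain n b' where b': "b = hb ^ n * b'" "res b' \<noteq> 0" using hb_factor by blast
  have "\<iota> hb ^ n * x * \<iota> b' = x * \<iota> b"
    unfolding b'(1) emb_mult emb_power by (simp only: emb_hb_power_left_commute mult.assoc)
  also have "\<dots> = \<iota> a" using ab by (simp add: mult.assoc emb_eq_0_iff)
  finally have "frac (\<iota> hb ^ n * x) a b'" using b' by (simp add: frac_def)
  then show "\<exists>n. \<iota> hb ^ n * x \<in> val_ring" using frac_val_ring by blast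
next
  fix x assume x: "\<And>n. \<exists>y\<in>val_ring. x = \<iota> hb ^ n * y"
  then obtain a b where ab: "frac x a b" using x[of 0] by (auto simp: val_ring_def)
  \<comment> \<open>Separatedness of D reduces to that of A: after passing to a common denominator,
    \<open>hb ^ n\<close> divides a u with u of nonzero residue, and therefore divides a.\<close>
  have "\<exists>y. a = hb ^ n * y" for n
  proof -
    obtain y c d where y: "frac y c d" "x = \<iota> hb ^ n * y" using x[of n] by (auto simp: val_ring_def)
    then have "frac x (hb ^ n * c) d" by (simp add: frac_def emb_mult emb_power mult.assoc)
    from common_denominator[OF ab this] obtain u v where
      uv: "res u \<noteq> 0" "frac x (a * u) (b * u)" "frac x (hb ^ n * c * v) (b * u)" by blast
    then have "a * u = hb ^ n * (c * v)" using emb_eq_iff by (simp add: frac_def mult.assoc)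
    then show ?thesis using hb_dvd_right[OF uv(1)] by blast
  qed
  then have "a = 0" by (rule hb_separated)
  then show "x = 0" using ab res_nz_imp_nz[of b] by (simp add: frac_def emb_zero)
qed

text \<open>An integer that is nonzero in F is invertible there, and its inverse acts on A0; if it
  were 0 in A0, then 1 would be 0 there as well.\<close>

lemma CHAR_residue_field: "CHAR('b fract) = CHAR('f)"
proof -
  have s: "s0 (of_nat n) 1 = of_nat n" for n
    by (induction n) (simp_all add: A0.scale_left_distrib)
  have eq: "of_nat n = (0::'b fract) \<longleftrightarrow> of_nat n = (0::'f)" for n
  proof -
    have "of_nat n = (0::'b fract) \<longleftrightarrow> of_nat n = (0::'b)"
      by (simp add: of_nat_fract Zero_fract_def eq_fract)
    also have "\<dots> \<longleftrightarrow> of_nat n = (0::'f)"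
    proof
      assume 0: "of_nat n = (0::'b)"
      show "of_nat n = (0::'f)"
      proof (rule ccontr)
        assume "of_nat n \<noteq> (0::'f)"
        then have "1 = s0 (inverse (of_nat n) * of_nat n) (1::'b)" by simp
        also have "\<dots> = s0 (inverse (of_nat n)) (s0 (of_nat n) 1)" by (simp only: A0.scale_scale)
        also have "\<dots> = 0" using 0 s[of n] by simp
        finally show False by simp
      qed
    qed (use s[of n] in simp)
    finally show ?thesis .
  qed
  show ?thesis
  proof (rule dvd_antisym)
    show "CHAR('b fract) dvd CHAR('f)"
      using eq[of "CHAR('f)"] of_nat_eq_0_iff_char_dvd[where ?'a = "'b fract", of "CHAR('f)"] by simp
    show "CHAR('f) dvd CHAR('b fract)"
      using eq[of "CHAR('b fract)"] of_nat_eq_0_iff_char_dvd[where ?'a = 'f, of "CHAR('b fract)"] by simp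
  qed
qed

end

section \<open>Conclusion for quantum formal deformations\<close>

theorem theorem3p1:
  fixes s0 :: "'f::alg_closed_field \<Rightarrow> 'a0::idom \<Rightarrow> 'a0"
    and sA :: "'f fps \<Rightarrow> 'a::ring_1 \<Rightarrow> 'a"
    and \<psi> :: "'a set \<Rightarrow> 'a0"
    and \<iota> :: "'a \<Rightarrow> 'd::division_ring"
    and d :: nat
  assumes "quantum_formal_deformation s0 sA \<psi>"
    and "PI_degree sA \<iota> d"
  shows "(CHAR('f) = 0 \<longrightarrow> d = 1 \<and> (\<forall>a b :: 'a. a * b = b * a)) \<and>
         (\<forall>p. CHAR('f) = p \<and> p > 0 \<longrightarrow> (\<exists>k. d = p ^ k))"
proof -
  interpret quantum_formal_deformation s0 sA \<psi> by fact
  interpret quotient_division_ring \<iota> using assms(2) by (simp add: PI_degree_def)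
  interpret deformation_fractions s0 sA \<psi> \<iota> ..
  obtain B :: "'d set" where B: "finite_dimensional_vector_space center_scale B" "card B = d\<^sup>2"
    using assms(2) by (auto simp: PI_degree_def)
  interpret fin: finite_dimensional_vector_space "center_scale :: 'd center \<Rightarrow> 'd \<Rightarrow> 'd" B by fact
  interpret finite_central_place val_ring "\<iota> hb" place B ..
  show ?thesis
  proof (intro conjI impI allI; (elim conjE)?)
    assume "CHAR('f) = 0"
    then have comm: "x * y = y * x" for x y :: 'd
      by (intro commutative_residue_char_0) (simp add: CHAR_residue_field)
    have "x \<in> center.span {1}" for x :: 'd
    proof -
      have "x * 1 \<in> center.span {1}"
        by (rule center_span_scale) (use comm in \<open>auto simp: central_def intro: center.span_base\<close>)
      then show ?thesis by simp
    qed
    then have "UNIV \<subseteq> center.span {1 :: 'd}" by blast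
    then have "center.dim (UNIV :: 'd set) \<le> card {1 :: 'd}"
      by (rule center.dim_le_card) simp
    moreover have "center.dim (UNIV :: 'd set) = card B"
      by (rule center.dim_eq_card) (simp_all add: fin.span_Basis fin.independent_Basis)
    ultimately have "card B \<le> 1" by simp
    then have "d\<^sup>2 \<le> 1" using B(2) by simp
    \<comment> \<open>An empty basis would span only 0, whereas D contains 1.\<close>
    moreover have "d \<noteq> 0"
    proof
      assume "d = 0"
      then have "B = {}" using B(2) fin.finite_Basis by simp
      then have "(1::'d) \<in> center.span {}" using fin.span_Basis by auto
      then show False by simp
    qed
    ultimately show "d = 1" by (metis One_nat_def Suc_leI le_antisym le_square le_trans neq0_conv power2_eq_square)
    fix a b :: 'a
    show "a * b = b * a" using comm by (metis emb_mult emb_eq_iff)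
  next
    fix p assume p: "CHAR('f) = p" "p > 0"
    then obtain e where "card B = p ^ e"
      using card_basis_residue_char CHAR_residue_field by metis
    \<comment> \<open>As d^2 = p^e, its divisor d is itself a power of the prime p.\<close>
    then have "d dvd p ^ e" using B(2) by (metis dvd_triv_left power2_eq_square)
    moreover have "prime p" using p prime_CHAR_semidom[where ?'a = 'f] by simp
    ultimately show "\<exists>k. d = p ^ k" using divides_primepow_nat by blast
  qed
qed

end
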